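(* Let $m,n$ be positive integers with $0<m<n$ and $\gcd(m,n)=1$. Let $\mathbb{K}$ be an imaginary quadratic field, $\mathbb{L}$ a number field with $[\mathbb{L}:\mathbb{K}]=2$, $\sigma$ the non-trivial element of $\mathrm{Gal}(\mathbb{L}/\mathbb{K})$, and $\tau$ an algebraic integer in $\mathbb{K}$ with $\mathbb{L}=\mathbb{K}(\sqrt{\tau})$. Let $\beta,\gamma,\eta$ be algebraic integers in $\mathbb{L}$. Let $g$ be an algebraic number such that $\eta/g$ and $\sigma(\eta)/g$ are algebraic integers. For each non-negative integer $r$ let $h_r$ be a non-zero algebraic integer with $h_r/g^r\in\mathbb{K}$ and $|h_r|\le h$, for some fixed positive real $h$. Let $d$ be the largest positive rational integer such that $(\sigma(\eta)-\eta)/(dg)$ is an algebraic integer, and let $\mathcal{C}_n,\mathcal{D}_n$ be positive real numbers such that $$\max\left(1,\frac{\Gamma(1-m/n)\,r!}{\Gamma(r+1-m/n)},\frac{n\Gamma(r+1+m/n)}{m\Gamma(m/n)\,r!}\right)\frac{D_{n,r}}{N_{d,n,r}}<\mathcal{C}_n\left(\frac{\mathcal{D}_n}{\mathcal{N}_{d,n}}\right)^r$$ for all non-negative integers $r$. Put $$\alpha=\frac{\beta(\eta/\sigma(\eta))^{m/n}\pm\sigma(\beta)}{\gamma(\eta/\sigma(\eta))^{m/n}\pm\sigma(\gamma)}$$ (the same sign in numerator and denominator), $$E=\frac{4|g|\mathcal{N}_{d,n}}{\mathcal{D}_n}\cdot\frac{|\eta|-|\sigma(\eta)-\eta|}{|\sigma(\eta)-\eta|^2},\qquad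 Q=\frac{2\mathcal{D}_n}{|g|\mathcal{N}_{d,n}}(|\eta|+|\sigma(\eta)|),$$ $\kappa=\frac{\log Q}{\log E}$, and $$c=4h|\sqrt{\tau}|(|\gamma|+|\sigma(\gamma)|)\mathcal{C}_nQ\max\left\{E,\;2h|\sqrt{\tau}|\,|1-(\eta/\sigma(\eta))^{m/n}|\,|\beta-\alpha\gamma|\,\mathcal{C}_nE\right\}^{\kappa}.$$ If $E>1$ and $\max(|1-\eta/\sigma(\eta)|,|1-\sigma(\eta)/\eta|)<1$, then $$|\alpha-p/q|>\frac{1}{c|q|^{\kappa+1}}$$ for all algebraic integers $p,q\in\mathbb{K}$ with $q\ne0$.
   Context: For positive integers $m<n$ with $\gcd(m,n)=1$ and a non-negative integer $r$, $X_{m,n,r}(x)={}_2F_1(-r,-r-m/n;1-m/n;x)$ (a polynomial of degree $r$, ${}_2F_1$ the Gauss hypergeometric function). $D_{n,r}$ is the smallest positive integer such that $D_{n,r}X_{m,n,r}(x)$ has rational integer coefficients. For a positive integer $d$, $N_{d,n,r}$ is the greatest common divisor of the numerators of the (rational) coefficients of the polynomial $X_{m,n,r}(1-dx)$. For a prime $p$, $v_p(x)$ is the exponent of $p$ in the rational number $x$, and $\mathcal{N}_{d,n}=\prod_{p\mid n}p^{\min(v_p(d),\,v_p(n)+1/(p-1))}$. For a complex number $w=|w|e^{i\varphi}$ with $-\pi<\varphi\le\pi$ ($\varphi=0$ if $w=0$), $w^{m/n}$ (in particular $\sqrt{w}=w^{1/2}$) denotes $(|w|^{1/n})^me^{im\varphi/n}$,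 with $|w|^{1/n}$ the non-negative real $n$-th root.
   Formalization: The formal theorem adds the hypothesis βσ(γ) ≠ γσ(β): otherwise γ=0 and α is undefined, or α=β/γ lies in K, and then p/q=α violates the claimed inequality (e.g. β=γ=1 gives α=1, p=q=1). *)

theory Defs
  imports
    "HOL-Analysis.Analysis"
    "HOL-Computational_Algebra.Computational_Algebra"
    "HOL-Algebra.Algebra"
    "HOL-Algebra.Algebraic_Closure_Type"
begin

(* Number fields are subfields of the complex numbers, so that absolute values of their elements
   are complex moduli.  This is the field of complex numbers as an HOL-Algebra structure. *)
abbreviation C_field :: "complex ring" where
  "C_field \<equiv> ring_of_type_algebra"

definition number_field :: "complex set \<Rightarrow> bool" where
  "number_field L \<longleftrightarrow> subfield L C_field \<and> ring.finite_dimension C_field \<rat> L"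

definition imaginary_quadratic_field :: "complex set \<Rightarrow> bool" where
  "imaginary_quadratic_field K \<longleftrightarrow>
     subfield K C_field \<and> ring.dimension C_field 2 \<rat> K \<and> \<not> K \<subseteq> \<real>"

(* Automorphisms are total functions on the complex numbers of which only the values on L matter. *)
definition Galois_group :: "complex set \<Rightarrow> complex set \<Rightarrow> (complex \<Rightarrow> complex) set" where
  "Galois_group L K =
     {\<sigma> \<in> ring_iso (C_field\<lparr>carrier := L\<rparr>) (C_field\<lparr>carrier := L\<rparr>). \<forall>x\<in>K. \<sigma> x = x}"

(* The hypergeometric series 2F1(-r, -r-m/n; 1-m/n; x) has no terms beyond x^r. *)
definition X_poly :: "nat \<Rightarrow> nat \<Rightarrow> nat \<Rightarrow> rat poly" where
  "X_poly m n r =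
     truncate_fps (Suc r)
       (fps_hypergeo [- of_nat r, - of_nat r - of_nat m / of_nat n] [1 - of_nat m / of_nat n] 1)"

lemma fps_of_poly_X_poly:
  "fps_of_poly (X_poly m n r) =
     fps_hypergeo [- of_nat r, - of_nat r - of_nat m / of_nat n] [1 - of_nat m / of_nat n] 1"
proof (rule fps_ext)
  fix k
  show "fps_of_poly (X_poly m n r) $ k =
     fps_hypergeo [- of_nat r, - of_nat r - of_nat m / of_nat n] [1 - of_nat m / of_nat n] 1 $ k"
  proof (cases "k < Suc r")
    case False
    then have "pochhammer (- of_nat r :: rat) k = 0"
      by (intro pochhammer_of_nat_eq_0_lemma) simp
    with False show ?thesis
      by (simp add: X_poly_def coeff_truncate_fps)
  qed (simp add: X_poly_def coeff_truncate_fps)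
qed

definition X_denom :: "nat \<Rightarrow> nat \<Rightarrow> nat \<Rightarrow> nat" where
  "X_denom m n r =
     (LEAST D. D > 0 \<and> (\<forall>k. of_nat D * Polynomial.coeff (X_poly m n r) k \<in> \<int>))"

definition X_numer_gcd :: "nat \<Rightarrow> nat \<Rightarrow> nat \<Rightarrow> nat \<Rightarrow> int" where
  "X_numer_gcd m n d r =
     Gcd (range (\<lambda>k. fst (quotient_of
       (Polynomial.coeff (pcompose (X_poly m n r) [:1, - of_nat d:]) k))))"

definition N_prod :: "nat \<Rightarrow> nat \<Rightarrow> real" where
  "N_prod d n =
     (\<Prod>p\<in>prime_factors n.
        real p powr min (real (multiplicity p d)) (real (multiplicity p n) + 1 / (real p - 1)))"

(* Complex powr and csqrt use the branch with argument in (-pi, pi]. *)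
lemma powr_rational_exponent:
  assumes "m > 0" "n > 0"
  shows "(w :: complex) powr of_real (real m / real n) =
     of_real (root n (cmod w) ^ m) * cis (real m * Arg w / real n)"
proof (cases "w = 0")
  case False
  have "w powr of_real (real m / real n) =
          of_real (exp (real m / real n * ln (cmod w))) * cis (real m * Arg w / real n)"
    using False
    by (simp add: powr_def Ln_Arg cis_conv_exp exp_of_real [symmetric] flip: exp_add)
       (simp add: algebra_simps add_divide_distrib)
  also have "exp (real m / real n * ln (cmod w)) = root n (cmod w) ^ m"
    using False assms
    by (simp add: root_powr_inverse powr_def flip: exp_of_nat_mult)
  finally show ?thesis .
qed (use assms in simp)

end

theory Submission
  imports Defs "Jordan_Normal_Form.Char_Poly"
begin

text \<open>
  Thue's method with hypergeometric polynomials. Write \<open>\<nu> = m/n\<close>, \<open>X r = X\<^bsub>m,n,r\<^esub>\<close> and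
  \<open>z = \<eta> / \<sigma> \<eta>\<close>. The difference \<open>z powr \<nu> * (z\<^sup>r X r (1/z)) - X r z\<close> equals
  \<open>c * \<integral> ((1 - t) (t - z))\<^sup>r t powr (\<nu> - r - 1) dt\<close>, integrated from \<open>1\<close> to \<open>z\<close>, and is small. So with
  \<open>P = \<eta>\<^sup>r X r (\<sigma> \<eta> / \<eta>)\<close> the quotient \<open>\<sigma> P / P\<close> is close to \<open>z powr \<nu>\<close>, and
  \<open>(\<beta> \<sigma> P \<plusminus> \<sigma> \<beta> P) / (\<gamma> \<sigma> P \<plusminus> \<sigma> \<gamma> P)\<close> is close to \<open>\<alpha>\<close>. Numerator and denominator are a trace
  from \<open>L\<close> to \<open>K\<close> or \<open>\<surd>\<tau>\<close> times an element of \<open>K\<close>, and become algebraic integers of \<open>K\<close> after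
  scaling. Consecutive approximations are distinct, and nonzero algebraic integers of an imaginary
  quadratic field have absolute value at least \<open>1\<close>, which yields the irrationality measure.
\<close>

section \<open>Algebraic integers form a ring\<close>

text \<open>Integrality rests on the substitution
  \<open>x = (\<eta> - \<sigma> \<eta>) / (d * \<eta>)\<close>, for which
  \<open>1 - d * x = \<sigma> \<eta> / \<eta>\<close>. Multiplied by
  \<open>(\<eta> / g) ^ r\<close>, the powers of \<open>x\<close> become products of the algebraic
  integers \<open>(\<eta> - \<sigma> \<eta>) / (d * g)\<close> and \<open>\<eta> / g\<close>, so one
  may not only clear denominators but also divide by the gcd of the numerators of the transformed
  polynomial. \<open>1 / E\<close> is the growth rate of this arithmetic factor times
  \<open>|\<sigma> \<eta>| / |g|\<close> times the bound
  \<open>|1 - z|^2 / (4 * (|z| - |1 - z|))\<close> for \<open>|(1 - t) * (t - z) / t|\<close> on the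
  segment; \<open>Q\<close> combines the same arithmetic rate with a binomial bound for the values
  of the polynomials. The exponent \<kappa> is the one with \<open>E powr \<kappa> = Q\<close>. Of
  two consecutive approximations only one need differ from a given fraction, which costs one extra
  factor \<open>Q\<close> in \<open>c\<close>.\<close>

lemma algebraic_int_if_int_combinations:
  fixes z :: "'a :: field_char_0" and v :: "'i \<Rightarrow> 'a" and a :: "'i \<Rightarrow> 'i \<Rightarrow> int"
  assumes fin: "finite I"
    and comb: "\<And>i. i \<in> I \<Longrightarrow> z * v i = (\<Sum>j\<in>I. of_int (a i j) * v j)"
    and nz: "i\<^sub>0 \<in> I" "v i\<^sub>0 \<noteq> 0"
  shows "algebraic_int z"
proof -
  define n where "n = card I"
  obtain f where f: "bij_betw f {0..<n} I"
    unfolding n_def using ex_bij_betw_nat_finite[OF fin] by blast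
  define A where "A = mat n n (\<lambda>(i, j). a (f i) (f j))"
  define B where "B = map_mat (of_int :: int \<Rightarrow> 'a) A"
  define w where "w = vec n (\<lambda>i. v (f i))"
  have fI: "f i \<in> I" if "i < n" for i
    using f that by (auto simp: bij_betw_def)
  have A: "A \<in> carrier_mat n n" by (simp add: A_def)
  then have B: "B \<in> carrier_mat n n" by (simp add: B_def)
  obtain k where k: "k < n" "f k = i\<^sub>0"
    using f nz by (auto simp: bij_betw_def image_iff)
  have "vec_index w k \<noteq> 0"
    using k nz by (simp add: w_def)
  then have w0: "w \<noteq> 0\<^sub>v n"
    using k by auto
  \<comment> \<open>In coordinates the hypothesis makes \<open>z\<close> an eigenvalue of an integer
    matrix, hence a root of a monic integer polynomial. The entry at \<open>i\<^sub>0\<close> makes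
    the eigenvector nonzero.\<close>
  have "B *\<^sub>v w = z \<cdot>\<^sub>v w"
  proof (rule eq_vecI)
    fix i assume "i < dim_vec (z \<cdot>\<^sub>v w)"
    then have i: "i < n" by (simp add: w_def)
    have "z * v (f i) = (\<Sum>j\<in>I. of_int (a (f i) j) * v j)"
      using comb fI[OF i] by blast
    also have "\<dots> = (\<Sum>j = 0..<n. of_int (a (f i) (f j)) * v (f j))"
      by (rule sum.reindex_bij_betw[OF f, of "\<lambda>j. of_int (a (f i) j) * v j", symmetric])
    finally show "vec_index (B *\<^sub>v w) i = vec_index (z \<cdot>\<^sub>v w) i"
      using i by (simp add: B_def A_def w_def scalar_prod_def)
  qed (use B in \<open>auto simp: w_def\<close>)
  then have "eigenvalue B z"
    using w0 B unfolding eigenvalue_def eigenvector_def by (auto simp: w_def intro!: exI[of _ w])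
  then have "poly (char_poly B) z = 0"
    using eigenvalue_root_char_poly[OF B] by simp
  moreover have "char_poly B = map_poly of_int (char_poly A)"
    unfolding B_def by (rule of_int_hom.char_poly_hom[OF A])
  moreover have "Polynomial.lead_coeff (char_poly A) = 1"
    using degree_monic_char_poly[OF A] by simp
  ultimately show ?thesis
    unfolding algebraic_int_altdef_ipoly by auto
qed

text \<open>Rows of the companion matrix: multiplication by \<open>x\<close> shifts the powers, and
  only the last one needs the monic equation of \<open>x\<close>.\<close>

lemma algebraic_int_power_combinations:
  fixes x :: "'a :: field_char_0"
  assumes "algebraic_int x"
  obtains n :: nat and a :: "nat \<Rightarrow> nat \<Rightarrow> int" where "n > 0"
    "\<And>i. i < n \<Longrightarrow> x * x ^ i = (\<Sum>j<n. of_int (a i j) * x ^ j)"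
proof -
  obtain p :: "int poly" where p: "poly (map_poly of_int p) x = 0" "Polynomial.lead_coeff p = 1"
    using assms unfolding algebraic_int_altdef_ipoly by blast
  define n where "n = Polynomial.degree p"
  have "(\<Sum>i\<le>n. of_int (Polynomial.coeff p i) * x ^ i) = 0"
    using p by (simp add: poly_altdef n_def)
  then have red: "x ^ n = (\<Sum>j<n. of_int (- Polynomial.coeff p j) * x ^ j)"
    using p by (simp add: sum_negf n_def eq_neg_iff_add_eq_0 add.commute flip: lessThan_Suc_atMost)
  define a :: "nat \<Rightarrow> nat \<Rightarrow> int" where
    "a = (\<lambda>i j. if Suc i < n then (if j = Suc i then 1 else 0) else - Polynomial.coeff p j)"
  show thesis
  proof
    show "n > 0"
      using red by (intro Nat.gr0I) simp
    fix i assume i: "i < n"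
    show "x * x ^ i = (\<Sum>j<n. of_int (a i j) * x ^ j)"
    proof (cases "Suc i < n")
      case True
      then have "(\<Sum>j<n. of_int (a i j) * x ^ j) = (\<Sum>j<n. if j = Suc i then x ^ j else 0)"
        by (intro sum.cong) (auto simp: a_def)
      with True show ?thesis by simp
    next
      case False
      with i have "Suc i = n" by simp
      with red False show ?thesis by (simp add: a_def flip: power_Suc)
    qed
  qed
qed

lemma algebraic_int_add:
  fixes x y :: "'a :: field_char_0"
  assumes "algebraic_int x" "algebraic_int y"
  shows "algebraic_int (x + y)"
proof -
  obtain n a where a: "n > 0" "\<And>i. i < n \<Longrightarrow> x * x ^ i = (\<Sum>j<n. of_int (a i j) * x ^ j)"
    using algebraic_int_power_combinations[OF assms(1)] by metis
  obtain m b where b: "m > 0" "\<And>i. i < m \<Longrightarrow> y * y ^ i = (\<Sum>j<m. of_int (b i j) * y ^ j)"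
    using algebraic_int_power_combinations[OF assms(2)] by metis
  \<comment> \<open>Kronecker sum: multiplication by \<open>x\<close> acts on the first index of
    \<open>x ^ i * y ^ j\<close>, by \<open>y\<close> on the second.\<close>
  define c :: "nat \<times> nat \<Rightarrow> nat \<times> nat \<Rightarrow> int" where
    "c = (\<lambda>(i, j) (k, l). a i k * of_bool (j = l) + of_bool (i = k) * b j l)"
  show ?thesis
  proof (rule algebraic_int_if_int_combinations)
    show "finite ({..<n} \<times> {..<m})" by simp
    show "(0, 0) \<in> {..<n} \<times> {..<m}" using a b by simp
    show "(\<lambda>(i, j). x ^ i * y ^ j) (0, 0) \<noteq> 0" by simp
    fix q assume "q \<in> {..<n} \<times> {..<m}"
    then obtain i j where q: "q = (i, j)" "i < n" "j < m" by auto
    have "(\<Sum>q'\<in>{..<n} \<times> {..<m}. of_int (c q q') * (\<lambda>(i, j). x ^ i * y ^ j) q') =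
      (\<Sum>k<n. \<Sum>l<m. (of_int (a i k) * x ^ k) * (if l = j then y ^ l else 0)) +
      (\<Sum>k<n. \<Sum>l<m. (if k = i then x ^ k else 0) * (of_int (b j l) * y ^ l))"
      unfolding sum.cartesian_product sum.distrib[symmetric]
      by (intro sum.cong) (auto simp: c_def q algebra_simps)
    also have "\<dots> = (\<Sum>k<n. of_int (a i k) * x ^ k) * (\<Sum>l<m. if l = j then y ^ l else 0) +
      (\<Sum>k<n. if k = i then x ^ k else 0) * (\<Sum>l<m. of_int (b j l) * y ^ l)"
      by (simp only: sum_product)
    also have "\<dots> = (x * x ^ i) * y ^ j + x ^ i * (y * y ^ j)"
      using q by (simp only: a(2)[OF q(2)] b(2)[OF q(3)]) simp
    also have "\<dots> = (x + y) * (x ^ i * y ^ j)"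
      by (simp add: algebra_simps)
    finally show "(x + y) * (\<lambda>(i, j). x ^ i * y ^ j) q =
      (\<Sum>q'\<in>{..<n} \<times> {..<m}. of_int (c q q') * (\<lambda>(i, j). x ^ i * y ^ j) q')"
      by (simp add: q)
  qed
qed

lemma algebraic_int_mult:
  fixes x y :: "'a :: field_char_0"
  assumes "algebraic_int x" "algebraic_int y"
  shows "algebraic_int (x * y)"
proof -
  obtain n a where a: "n > 0" "\<And>i. i < n \<Longrightarrow> x * x ^ i = (\<Sum>j<n. of_int (a i j) * x ^ j)"
    using algebraic_int_power_combinations[OF assms(1)] by metis
  obtain m b where b: "m > 0" "\<And>i. i < m \<Longrightarrow> y * y ^ i = (\<Sum>j<m. of_int (b i j) * y ^ j)"
    using algebraic_int_power_combinations[OF assms(2)] by metis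
  \<comment> \<open>Kronecker product of the two matrices.\<close>
  define c :: "nat \<times> nat \<Rightarrow> nat \<times> nat \<Rightarrow> int" where
    "c = (\<lambda>(i, j) (k, l). a i k * b j l)"
  show ?thesis
  proof (rule algebraic_int_if_int_combinations)
    show "finite ({..<n} \<times> {..<m})" by simp
    show "(0, 0) \<in> {..<n} \<times> {..<m}" using a b by simp
    show "(\<lambda>(i, j). x ^ i * y ^ j) (0, 0) \<noteq> 0" by simp
    fix q assume "q \<in> {..<n} \<times> {..<m}"
    then obtain i j where q: "q = (i, j)" "i < n" "j < m" by auto
    have "(x * y) * (x ^ i * y ^ j) = (x * x ^ i) * (y * y ^ j)"
      by (simp add: algebra_simps)
    also have "\<dots> = (\<Sum>k<n. \<Sum>l<m. (of_int (a i k) * x ^ k) * (of_int (b j l) * y ^ l))"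
      using a(2)[OF q(2)] b(2)[OF q(3)] by (simp add: sum_product)
    also have "\<dots> = (\<Sum>q'\<in>{..<n} \<times> {..<m}. of_int (c q q') * (\<lambda>(i, j). x ^ i * y ^ j) q')"
      unfolding sum.cartesian_product by (intro sum.cong) (auto simp: c_def q algebra_simps)
    finally show "(x * y) * (\<lambda>(i, j). x ^ i * y ^ j) q =
      (\<Sum>q'\<in>{..<n} \<times> {..<m}. of_int (c q q') * (\<lambda>(i, j). x ^ i * y ^ j) q')"
      by (simp add: q)
  qed
qed

lemma algebraic_int_diff:
  fixes x y :: "'a :: field_char_0"
  assumes "algebraic_int x" "algebraic_int y"
  shows "algebraic_int (x - y)"
  using algebraic_int_add[of x "- y"] assms by simp

lemma algebraic_int_power:
  fixes x :: "'a :: field_char_0"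
  assumes "algebraic_int x"
  shows "algebraic_int (x ^ k)"
  by (induction k) (auto intro: algebraic_int_mult assms)

lemma algebraic_int_sum:
  fixes f :: "'i \<Rightarrow> 'a :: field_char_0"
  assumes "\<And>i. i \<in> I \<Longrightarrow> algebraic_int (f i)"
  shows "algebraic_int (sum f I)"
  using assms by (induction I rule: infinite_finite_induct) (auto intro: algebraic_int_add)

section \<open>Hypergeometric approximations to fractional powers\<close>

lemma sum_choose_Suc:
  fixes f :: "nat \<Rightarrow> 'a :: comm_semiring_1"
  shows "(\<Sum>i\<le>Suc r. of_nat (Suc r choose i) * f i) =
    (\<Sum>i\<le>r. of_nat (r choose i) * f i) + (\<Sum>i\<le>r. of_nat (r choose i) * f (Suc i))"
proof -
  have "(\<Sum>i\<le>r. of_nat (r choose i) * f i) = (\<Sum>i\<le>Suc r. of_nat (r choose i) * f i)"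
    by (simp add: binomial_eq_0)
  also have "\<dots> = f 0 + (\<Sum>i\<le>r. of_nat (r choose Suc i) * f (Suc i))"
    by (subst sum.atMost_Suc_shift) simp
  finally show ?thesis
    by (subst sum.atMost_Suc_shift) (simp add: sum.distrib distrib_right add_ac)
qed

text \<open>For real \<open>x > 0\<close> this is the Beta integral of
  \<open>t powr (x - 1) * (1 - t) ^ r\<close> over the unit interval. By Pascal's rule the case
  \<open>Suc r\<close> at \<open>x\<close> is the difference of the cases \<open>r\<close> at
  \<open>x\<close> and at \<open>x + 1\<close>.\<close>

lemma sum_choose_alternating_partial_fractions:
  fixes x :: "'a :: field_char_0"
  assumes "\<And>i. i \<le> r \<Longrightarrow> x + of_nat i \<noteq> 0"
  shows "(\<Sum>i\<le>r. (-1) ^ i * of_nat (r choose i) / (x + of_nat i)) = fact r / pochhammer x (Suc r)"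
  using assms
proof (induction r arbitrary: x)
  case (Suc r)
  have x: "x \<noteq> 0" "x + of_nat (Suc r) \<noteq> 0"
    using Suc.prems[of 0] Suc.prems[of "Suc r"] by simp_all
  have P: "pochhammer x (Suc (Suc r)) = x * pochhammer (x + 1) (Suc r)"
    "pochhammer x (Suc (Suc r)) = pochhammer x (Suc r) * (x + of_nat (Suc r))"
    by (rule pochhammer_rec, rule pochhammer_Suc)
  have nz: "pochhammer x (Suc (Suc r)) \<noteq> 0"
  proof
    assume "pochhammer x (Suc (Suc r)) = 0"
    then obtain k where "k < Suc (Suc r)" "x = - of_nat k"
      unfolding pochhammer_eq_0_iff by blast
    with Suc.prems[of k] show False by simp
  qed
  have "(\<Sum>i\<le>r. (-1) ^ i * of_nat (r choose i) / (x + of_nat i)) = fact r / pochhammer x (Suc r)"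
    using Suc.prems by (intro Suc.IH) simp
  also have "\<dots> = fact r * (x + of_nat (Suc r)) / pochhammer x (Suc (Suc r))"
    using P(2) nz x by simp
  finally have 1: "(\<Sum>i\<le>r. (-1) ^ i * of_nat (r choose i) / (x + of_nat i)) =
    fact r * (x + of_nat (Suc r)) / pochhammer x (Suc (Suc r))" .
  have "(\<Sum>i\<le>r. (-1) ^ i * of_nat (r choose i) / (x + 1 + of_nat i)) =
    fact r / pochhammer (x + 1) (Suc r)"
  proof (rule Suc.IH)
    fix i assume "i \<le> r"
    then show "x + 1 + of_nat i \<noteq> 0"
      using Suc.prems[of "Suc i"] by (simp add: add_ac)
  qed
  also have "\<dots> = fact r * x / pochhammer x (Suc (Suc r))"
    using P(1) nz x by simp
  finally have 2: "(\<Sum>i\<le>r. (-1) ^ i * of_nat (r choose i) / (x + 1 + of_nat i)) =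
    fact r * x / pochhammer x (Suc (Suc r))" .
  have "(\<Sum>i\<le>Suc r. (-1) ^ i * of_nat (Suc r choose i) / (x + of_nat i)) =
    (\<Sum>i\<le>Suc r. of_nat (Suc r choose i) * ((-1) ^ i / (x + of_nat i)))"
    by (intro sum.cong) simp_all
  also have "\<dots> = (\<Sum>i\<le>r. (-1) ^ i * of_nat (r choose i) / (x + of_nat i)) -
      (\<Sum>i\<le>r. (-1) ^ i * of_nat (r choose i) / (x + 1 + of_nat i))"
    unfolding sum_choose_Suc by (simp add: sum_negf add_ac mult.commute)
  also have "\<dots> = fact (Suc r) / pochhammer x (Suc (Suc r))"
    unfolding 1 2 by (simp add: algebra_simps flip: diff_divide_distrib)
  finally show ?case .
qed simp

text \<open>The product is split just before the factor \<open>\<nu>\<close>; the lower part,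
  reversed, has the factors \<open>-(1 - \<nu>), ..., -(k - \<nu>)\<close>.\<close>

lemma pochhammer_across_zero:
  fixes \<nu> :: real
  assumes "k \<le> r"
  shows "pochhammer (\<nu> - real k) (Suc r) =
    (-1) ^ k * pochhammer (1 - \<nu>) k * \<nu> * pochhammer (1 + \<nu>) (r - k)"
proof -
  have "pochhammer (\<nu> - real k) (Suc r) = pochhammer (\<nu> - real k) k * pochhammer \<nu> (Suc r - k)"
    using pochhammer_product[of k "Suc r" "\<nu> - real k"] assms by simp
  also have "pochhammer (\<nu> - real k) k = (-1) ^ k * pochhammer (1 - \<nu>) k"
    using pochhammer_minus[of "real k - \<nu>" k] by (simp add: add.commute)
  also have "pochhammer \<nu> (Suc r - k) = \<nu> * pochhammer (1 + \<nu>) (r - k)"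
    using assms by (simp add: Suc_diff_le pochhammer_rec add.commute)
  finally show ?thesis by simp
qed

text \<open>
  With \<open>\<nu> = m/n\<close>, \<open>hyp_poly \<nu> r\<close> is \<open>X\<^bsub>m,n,r\<^esub>\<close> (see \<open>map_poly_X_poly\<close> and
  \<open>hyp_coeff_altdef\<close> below) and \<open>hyp_rev \<nu> r\<close> is \<open>z\<^sup>r X\<^bsub>m,n,r\<^esub>(1/z)\<close>.
\<close>

definition hyp_coeff :: "real \<Rightarrow> nat \<Rightarrow> nat \<Rightarrow> real" where
  "hyp_coeff \<nu> r k = real (r choose k) * pochhammer (1 + \<nu>) r /
     (pochhammer (1 + \<nu>) (r - k) * pochhammer (1 - \<nu>) k)"

definition hyp_poly :: "real \<Rightarrow> nat \<Rightarrow> complex poly" where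
  "hyp_poly \<nu> r = (\<Sum>k\<le>r. Polynomial.monom (of_real (hyp_coeff \<nu> r k)) k)"

definition hyp_rev :: "real \<Rightarrow> nat \<Rightarrow> complex poly" where
  "hyp_rev \<nu> r = (\<Sum>k\<le>r. Polynomial.monom (of_real (hyp_coeff \<nu> r (r - k))) k)"

lemma poly_hyp_poly: "poly (hyp_poly \<nu> r) z = (\<Sum>k\<le>r. of_real (hyp_coeff \<nu> r k) * z ^ k)"
  by (simp add: hyp_poly_def poly_sum poly_monom)

lemma poly_hyp_rev: "poly (hyp_rev \<nu> r) z = (\<Sum>k\<le>r. of_real (hyp_coeff \<nu> r (r - k)) * z ^ k)"
  by (simp add: hyp_rev_def poly_sum poly_monom)

lemma poly_hyp_rev_nz:
  assumes "z \<noteq> 0"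
  shows "poly (hyp_rev \<nu> r) z = z ^ r * poly (hyp_poly \<nu> r) (1 / z)"
proof -
  have "poly (hyp_rev \<nu> r) z = (\<Sum>k\<le>r. of_real (hyp_coeff \<nu> r k) * z ^ (r - k))"
    unfolding poly_hyp_rev
    by (rule sum.reindex_bij_witness[of _ "\<lambda>k. r - k" "\<lambda>k. r - k"]) auto
  also have "\<dots> = z ^ r * poly (hyp_poly \<nu> r) (1 / z)"
    unfolding poly_hyp_poly sum_distrib_left
    using assms by (intro sum.cong) (auto simp: power_diff field_simps)
  finally show ?thesis .
qed

context
  fixes \<nu> :: real
  assumes \<nu>: "0 < \<nu>" "\<nu> < 1"
begin

lemma pochhammer_\<nu>_pos: "pochhammer (1 + \<nu>) k > 0" "pochhammer (1 - \<nu>) k > 0"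
  using \<nu> by (auto intro!: pochhammer_pos)

lemma hyp_coeff_nonneg: "hyp_coeff \<nu> r k \<ge> 0"
  using pochhammer_\<nu>_pos by (simp add: hyp_coeff_def less_imp_le)

text \<open>Since \<open>\<nu>\<close> is not an integer, no exponent in the antiderivative below
  vanishes and no logarithm arises.\<close>

lemma \<nu>_shift_nonzero: "\<nu> + real i - real j \<noteq> 0"
proof
  assume "\<nu> + real i - real j = 0"
  then have "\<nu> = of_int (int j - int i)" by simp
  with \<nu> show False by simp
qed

text \<open>
  \<open>rem_primitive r z\<close> is an antiderivative of \<open>c (1 - t)\<^sup>r (t - z)\<^sup>r t powr (\<nu> - r - 1)\<close>,
  obtained by expanding both binomials. Its values at \<open>1\<close> and at \<open>z\<close> are the two terms of the
  remainder, which is therefore an integral along the segment from \<open>1\<close> to \<open>z\<close>.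
\<close>

definition rem_coeff :: "nat \<Rightarrow> nat \<Rightarrow> nat \<Rightarrow> real" where
  "rem_coeff r i j = (-1) ^ (i + j) * real (r choose i) * real (r choose j) / (\<nu> + real i - real j)"

text \<open>The partial fraction identity at \<open>\<nu> - j\<close>. The factor
  \<open>\<nu> * (pochhammer (1 + \<nu>) r / fact r)\<close> normalises the constant coefficient of
  the polynomial to \<open>1\<close>.\<close>

lemma sum_rem_coeff_left:
  assumes "j \<le> r"
  shows "(\<Sum>i\<le>r. rem_coeff r i j) * (\<nu> * (pochhammer (1 + \<nu>) r / fact r)) = hyp_coeff \<nu> r j"
proof -
  have "(\<Sum>i\<le>r. (-1) ^ i * real (r choose i) / (\<nu> - real j + real i)) =
    fact r / pochhammer (\<nu> - real j) (Suc r)"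
    using \<nu>_shift_nonzero[of _ j] by (intro sum_choose_alternating_partial_fractions)
      (simp add: algebra_simps)
  moreover have "(\<Sum>i\<le>r. rem_coeff r i j) =
    (-1) ^ j * real (r choose j) * (\<Sum>i\<le>r. (-1) ^ i * real (r choose i) / (\<nu> - real j + real i))"
    unfolding rem_coeff_def sum_distrib_left
    by (intro sum.cong) (simp_all add: power_add diff_add_eq)
  ultimately have "(\<Sum>i\<le>r. rem_coeff r i j) =
    (-1) ^ j * real (r choose j) * (fact r / pochhammer (\<nu> - real j) (Suc r))"
    by simp
  also have "\<dots> = real (r choose j) * fact r /
      (pochhammer (1 - \<nu>) j * \<nu> * pochhammer (1 + \<nu>) (r - j))"
    unfolding pochhammer_across_zero[OF assms] by simp
  finally show ?thesis
    using \<nu> pochhammer_\<nu>_pos by (simp add: hyp_coeff_def field_simps)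
qed

text \<open>The symmetry \<open>(i, j) \<mapsto> (r - j, r - i)\<close> of \<open>rem_coeff\<close>,
  which preserves \<open>i - j\<close>, exchanges the two kinds of sums.\<close>

lemma sum_rem_coeff_right:
  assumes "i \<le> r"
  shows "(\<Sum>j\<le>r. rem_coeff r i j) * (\<nu> * (pochhammer (1 + \<nu>) r / fact r)) = hyp_coeff \<nu> r (r - i)"
proof -
  have "(\<Sum>j\<le>r. rem_coeff r i j) = (\<Sum>j\<le>r. rem_coeff r i (r - j))"
    by (rule sum.reindex_bij_witness[of _ "\<lambda>k. r - k" "\<lambda>k. r - k"]) auto
  also have "\<dots> = (\<Sum>j\<le>r. rem_coeff r j (r - i))"
  proof (intro sum.cong refl)
    fix j assume j: "j \<in> {..r}"
    have "even (i + (r - j)) \<longleftrightarrow> even (j + (r - i))"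
      using j assms by (auto simp: even_diff_nat)
    then have "(-1 :: real) ^ (i + (r - j)) = (-1) ^ (j + (r - i))"
      by (metis neg_one_even_power neg_one_odd_power)
    then show "rem_coeff r i (r - j) = rem_coeff r j (r - i)"
      using j assms by (simp add: rem_coeff_def binomial_symmetric[symmetric] of_nat_diff algebra_simps)
  qed
  finally show ?thesis
    using sum_rem_coeff_left[of "r - i" r] by simp
qed

definition rem_primitive :: "nat \<Rightarrow> complex \<Rightarrow> complex \<Rightarrow> complex" where
  "rem_primitive r z t = of_real (\<nu> * (pochhammer (1 + \<nu>) r / fact r)) *
     (\<Sum>i\<le>r. \<Sum>j\<le>r. of_real (rem_coeff r i j) * z ^ j * t powr of_real (\<nu> + real i - real j))"

lemma rem_primitive_at_1: "rem_primitive r z 1 = poly (hyp_poly \<nu> r) z"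
proof -
  define c where "c = \<nu> * (pochhammer (1 + \<nu>) r / fact r)"
  have "rem_primitive r z 1 = of_real c * (\<Sum>j\<le>r. \<Sum>i\<le>r. of_real (rem_coeff r i j) * z ^ j)"
    unfolding rem_primitive_def c_def by (subst sum.swap) simp
  also have "\<dots> = (\<Sum>j\<le>r. of_real ((\<Sum>i\<le>r. rem_coeff r i j) * c) * z ^ j)"
    by (simp add: sum_distrib_left sum_distrib_right mult_ac)
  also have "\<dots> = poly (hyp_poly \<nu> r) z"
    unfolding poly_hyp_poly c_def by (intro sum.cong refl) (simp only: sum_rem_coeff_left atMost_iff)
  finally show ?thesis .
qed

lemma rem_primitive_at_z:
  assumes "z \<noteq> 0"
  shows "rem_primitive r z z = z powr of_real \<nu> * poly (hyp_rev \<nu> r) z"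
proof -
  define c where "c = \<nu> * (pochhammer (1 + \<nu>) r / fact r)"
  have pow: "z ^ j * z powr of_real (\<nu> + real i - real j) = z powr of_real \<nu> * z ^ i" for i j
  proof -
    have "of_real (\<nu> + real i - real j) = of_real \<nu> + of_nat i - (of_nat j :: complex)"
      by simp
    then show ?thesis
      using assms by (simp add: powr_add powr_diff powr_nat')
  qed
  have "rem_primitive r z z = of_real c *
      (\<Sum>i\<le>r. \<Sum>j\<le>r. of_real (rem_coeff r i j) * (z powr of_real \<nu> * z ^ i))"
    unfolding rem_primitive_def c_def by (simp only: mult.assoc pow)
  also have "\<dots> = z powr of_real \<nu> * (\<Sum>i\<le>r. of_real ((\<Sum>j\<le>r. rem_coeff r i j) * c) * z ^ i)"
    by (simp add: sum_distrib_left sum_distrib_right mult_ac)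
  also have "\<dots> = z powr of_real \<nu> * poly (hyp_rev \<nu> r) z"
    unfolding poly_hyp_rev c_def
    by (intro arg_cong2[of _ _ _ _ "(*)"] sum.cong refl) (simp only: sum_rem_coeff_right atMost_iff)
  finally show ?thesis .
qed

lemma rem_primitive_has_field_derivative:
  assumes "t \<notin> \<real>\<^sub>\<le>\<^sub>0"
  shows "(rem_primitive r z has_field_derivative
     of_real (\<nu> * (pochhammer (1 + \<nu>) r / fact r)) *
       ((1 - t) ^ r * (t - z) ^ r * t powr of_real (\<nu> - 1) / t ^ r)) (at t)"
proof -
  have t: "t \<noteq> 0" using assms by auto
  have "(rem_primitive r z has_field_derivative of_real (\<nu> * (pochhammer (1 + \<nu>) r / fact r)) *
     (\<Sum>i\<le>r. \<Sum>j\<le>r. of_real (rem_coeff r i j) * z ^ j *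
        (of_real (\<nu> + real i - real j) * t powr (of_real (\<nu> + real i - real j) - 1)))) (at t)"
    unfolding rem_primitive_def
    by (intro DERIV_cmult DERIV_sum has_field_derivative_powr assms)
  moreover have "(\<Sum>i\<le>r. \<Sum>j\<le>r. of_real (rem_coeff r i j) * z ^ j *
        (of_real (\<nu> + real i - real j) * t powr (of_real (\<nu> + real i - real j) - 1))) =
      (1 - t) ^ r * (t - z) ^ r * t powr of_real (\<nu> - 1) / t ^ r"
  proof -
    \<comment> \<open>The factor \<open>\<nu> + i - j\<close> from differentiation cancels the
      denominator of \<open>rem_coeff\<close>; what remains separates into a term in
      \<open>i\<close> and a term in \<open>j\<close>.\<close>
    have summand: "of_real (rem_coeff r i j) * z ^ j *
        (of_real (\<nu> + real i - real j) * t powr (of_real (\<nu> + real i - real j) - 1)) =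
      (of_nat (r choose i) * (- t) ^ i * 1 ^ (r - i)) * (of_nat (r choose j) * (- z) ^ j * t ^ (r - j)) *
        (t powr of_real (\<nu> - 1) / t ^ r)" if "i \<le> r" "j \<le> r" for i j
    proof -
      have 1: "of_real (rem_coeff r i j) * of_real (\<nu> + real i - real j) =
          ((-1) ^ (i + j) * of_nat (r choose i) * of_nat (r choose j) :: complex)"
        unfolding of_real_mult[symmetric] rem_coeff_def using \<nu>_shift_nonzero[of i j] by simp
      have 2: "t powr (of_real (\<nu> + real i - real j) - 1) = t powr of_real (\<nu> - 1) * t ^ i / t ^ j"
      proof -
        have "of_real (\<nu> + real i - real j) - 1 = of_real (\<nu> - 1) + of_nat i - (of_nat j :: complex)"
          by simp
        then show ?thesis
          using t by (simp only: powr_add powr_diff powr_nat' simp_thms)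
      qed
      have "of_real (rem_coeff r i j) * z ^ j *
        (of_real (\<nu> + real i - real j) * t powr (of_real (\<nu> + real i - real j) - 1)) =
        (of_real (rem_coeff r i j) * of_real (\<nu> + real i - real j)) * z ^ j *
          t powr (of_real (\<nu> + real i - real j) - 1)"
        by (simp only: mult_ac)
      also have "\<dots> = (-1) ^ (i + j) * of_nat (r choose i) * of_nat (r choose j) * z ^ j *
          (t powr of_real (\<nu> - 1) * t ^ i / t ^ j)"
        unfolding 1 2 ..
      also have "\<dots> = (of_nat (r choose i) * (- t) ^ i * 1 ^ (r - i)) *
          (of_nat (r choose j) * (- z) ^ j * t ^ (r - j)) * (t powr of_real (\<nu> - 1) / t ^ r)"
        using t that
        by (simp add: power_diff power_minus[of t] power_minus[of z] power_add field_simps)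
      finally show ?thesis .
    qed
    have "(1 - t) ^ r * (t - z) ^ r = (- t + 1) ^ r * (- z + t) ^ r"
      by (simp add: algebra_simps)
    also have "\<dots> = (\<Sum>i\<le>r. of_nat (r choose i) * (- t) ^ i * 1 ^ (r - i)) *
      (\<Sum>j\<le>r. of_nat (r choose j) * (- z) ^ j * t ^ (r - j))"
      by (simp only: binomial_ring)
    finally have "(1 - t) ^ r * (t - z) ^ r * t powr of_real (\<nu> - 1) / t ^ r =
      (\<Sum>i\<le>r. of_nat (r choose i) * (- t) ^ i * 1 ^ (r - i)) *
      (\<Sum>j\<le>r. of_nat (r choose j) * (- z) ^ j * t ^ (r - j)) * (t powr of_real (\<nu> - 1) / t ^ r)"
      by simp
    also have "\<dots> = (\<Sum>i\<le>r. \<Sum>j\<le>r. (of_nat (r choose i) * (- t) ^ i * 1 ^ (r - i)) *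
      (of_nat (r choose j) * (- z) ^ j * t ^ (r - j)) * (t powr of_real (\<nu> - 1) / t ^ r))"
      by (simp only: sum_product) (simp only: sum_distrib_right)
    also have "\<dots> = (\<Sum>i\<le>r. \<Sum>j\<le>r. of_real (rem_coeff r i j) * z ^ j *
        (of_real (\<nu> + real i - real j) * t powr (of_real (\<nu> + real i - real j) - 1)))"
      by (intro sum.cong refl) (simp only: summand atMost_iff)
    finally show ?thesis ..
  qed
  ultimately show ?thesis by (simp only:)
qed

text \<open>
  To keep the exact factor \<open>|1 - z powr \<nu>|\<close>, the norm of the integrand is not compared with
  \<open>|t powr (\<nu> - 1)|\<close> but with the real part of \<open>t powr (\<nu> - 1)\<close>, whose integral is explicit.
  The factor \<open>Re t / |t|\<close> lost in this way is gained back from \<open>(1 - t) (t - z) / t\<close>.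
\<close>

lemma norm_powr_times_cos_Arg_le:
  assumes "Re t > 0"
  shows "cmod t powr (\<nu> - 1) * (Re t / cmod t) \<le> Re (t powr of_real (\<nu> - 1))"
proof -
  have t: "t \<noteq> 0" using assms by auto
  define \<theta> where "\<theta> = Im (Ln t)"
  have "\<bar>\<theta>\<bar> < pi / 2"
    unfolding \<theta>_def using Re_Ln_pos_lt_imp assms by blast
  have "Re t / cmod t = cos \<theta>"
  proof -
    have "t = exp (Ln t)" using t by simp
    then have "Re t = exp (Re (Ln t)) * cos \<theta>" unfolding \<theta>_def by (metis Re_exp)
    then show ?thesis using t by simp
  qed
  also have "\<dots> = cos \<bar>\<theta>\<bar>" by simp
  \<comment> \<open>As \<open>|\<nu> - 1| < 1\<close>, the power has a smaller argument than
    \<open>t\<close> in absolute value, and the cosine decreases on \<open>[0, pi]\<close>.\<close>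
  also have "\<dots> \<le> cos \<bar>(\<nu> - 1) * \<theta>\<bar>"
  proof (rule cos_monotone_0_pi_le)
    show "\<bar>(\<nu> - 1) * \<theta>\<bar> \<le> \<bar>\<theta>\<bar>"
      unfolding abs_mult using \<nu> by (intro mult_left_le_one_le) auto
    show "\<bar>\<theta>\<bar> \<le> pi" using \<open>\<bar>\<theta>\<bar> < pi / 2\<close> by linarith
  qed simp
  also have "\<dots> = cos ((\<nu> - 1) * \<theta>)" by simp
  finally have "cmod t powr (\<nu> - 1) * (Re t / cmod t) \<le> cmod t powr (\<nu> - 1) * cos ((\<nu> - 1) * \<theta>)"
    by (intro mult_left_mono) auto
  also have "\<dots> = Re (t powr of_real (\<nu> - 1))"
    using t by (simp add: powr_def Re_exp \<theta>_def)
  finally show ?thesis .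
qed

text \<open>On the segment \<open>|1 - t| * |t - z| = s * (1 - s) * |1 - z|^2\<close>. The lower
  bound for \<open>Re t\<close> therefore bounds \<open>|(1 - t) * (t - z) / t|\<close> by
  \<open>|1 - z|^2 / (4 * (|z| - |1 - z|))\<close> times \<open>Re t / |t|\<close>.\<close>

lemma segment_Re_ge:
  fixes z :: complex
  assumes "cmod (1 - z) < cmod z" "cmod (1 - z) < 1" "0 \<le> s" "s \<le> 1"
  shows "4 * s * (1 - s) * (cmod z - cmod (1 - z)) \<le> Re (1 + of_real s * (z - 1))"
    and "Re (1 + of_real s * (z - 1)) > 0"
proof -
  define x D where "x = Re z" and "D = cmod z - cmod (1 - z)"
  have D: "D > 0" "D \<le> 1"
    using assms norm_triangle_ineq4[of 1 "1 - z"] by (auto simp: D_def)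
  have "D * (cmod z + cmod (1 - z)) = cmod z ^ 2 - cmod (1 - z) ^ 2"
    by (simp add: D_def power2_eq_square algebra_simps)
  also have "\<dots> = 2 * x - 1"
    by (simp only: cmod_power2) (simp add: x_def power2_eq_square algebra_simps)
  finally have eq: "D * (cmod z + cmod (1 - z)) = 2 * x - 1" .
  \<comment> \<open>Dropping this factor gives \<open>D \<le> 2 * x - 1\<close>, which leaves an
    inequality in \<open>s\<close> and \<open>x\<close> only.\<close>
  have "cmod z + cmod (1 - z) \<ge> 1"
    using norm_triangle_ineq[of z "1 - z"] by simp
  with D have "D * 1 \<le> D * (cmod z + cmod (1 - z))"
    by (intro mult_left_mono) auto
  with eq have Dx: "D \<le> 2 * x - 1" by simp
  have Re: "Re (1 + of_real s * (z - 1)) = 1 + s * (x - 1)"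
    by (simp add: x_def)
  have s01: "4 * s * (1 - s) \<ge> 0" "4 * s * (1 - s) \<le> 1"
    using assms zero_le_power2[of "2 * s - 1"] mult_nonneg_nonneg[of s "1 - s"]
    by (auto simp: power2_eq_square algebra_simps)
  have "s * (1 - x) \<le> 1 * (1 / 2)" if "x \<le> 1"
    using assms D Dx that by (intro mult_mono) auto
  moreover have "s * (1 - x) \<le> 0" if "x > 1"
    using assms that by (simp add: mult_nonneg_nonpos)
  ultimately have "s * (1 - x) \<le> 1 / 2" by force
  then show "Re (1 + of_real s * (z - 1)) > 0"
    unfolding Re by (simp add: algebra_simps)
  have "4 * s * (1 - s) * D \<le> 1 + s * (x - 1)"
  proof (cases "x \<ge> 1")
    case True
    have "4 * s * (1 - s) * D \<le> 1 * 1"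
      using s01 D by (intro mult_mono) auto
    also have "\<dots> \<le> 1 + s * (x - 1)"
      using True assms by simp
    finally show ?thesis .
  next
    case False
    define y where "y = 1 - x"
    have y: "0 \<le> y" "y \<le> 1 / 2"
      using False D Dx by (auto simp: y_def)
    have "4 * s * (1 - s) * D \<le> 4 * s * (1 - s) * (1 - 2 * y)"
      using Dx s01 by (intro mult_left_mono) (auto simp: y_def)
    also have "\<dots> \<le> 1 - s * y"
    proof -
      have "0 \<le> (1 - 2 * y) * (1 - 2 * s)\<^sup>2 + y * (2 - s)"
        using y assms by (intro add_nonneg_nonneg mult_nonneg_nonneg) auto
      also have "\<dots> = 1 - s * y - 4 * s * (1 - s) * (1 - 2 * y)"
        by (simp add: power2_eq_square algebra_simps)
      finally show ?thesis by simp
    qed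
    finally show ?thesis by (simp add: y_def algebra_simps)
  qed
  then show "4 * s * (1 - s) * (cmod z - cmod (1 - z)) \<le> Re (1 + of_real s * (z - 1))"
    unfolding Re D_def .
qed

text \<open>Along the segment the derivative of \<open>rem_primitive\<close> is dominated by that of
  a real function \<open>\<psi>\<close>, a multiple of the component of \<open>t powr \<nu>\<close>
  in a fixed direction. The increment of that component is at most
  \<open>|1 - z powr \<nu>|\<close>.\<close>

lemma hyp_remainder_bound:
  assumes z: "cmod (1 - z) < cmod z" "cmod (1 - z) < 1"
  shows "cmod (z powr of_real \<nu> * poly (hyp_rev \<nu> r) z - poly (hyp_poly \<nu> r) z) \<le>
    pochhammer (1 + \<nu>) r / fact r * cmod (1 - z powr of_real \<nu>) *
      ((cmod (1 - z))\<^sup>2 / (4 * (cmod z - cmod (1 - z)))) ^ r"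
proof (cases r)
  case 0
  then show ?thesis
    by (simp add: poly_hyp_poly poly_hyp_rev hyp_coeff_def norm_minus_commute)
next
  case (Suc r')
  define G D \<delta> M where "G = pochhammer (1 + \<nu>) r / fact r" and "D = cmod z - cmod (1 - z)"
    and "\<delta> = cmod (1 - z)" and "M = \<delta>\<^sup>2 / (4 * D)"
  define T where "T s = 1 + of_real s * (z - 1)" for s :: real
  \<comment> \<open>Rotates \<open>z - 1\<close> onto the positive real axis, so that
    \<open>\<psi>'\<close> is a nonnegative multiple of \<open>Re (t powr (\<nu> - 1))\<close>; for
    \<open>z = 1\<close> it is \<open>0\<close>.\<close>
  define u where "u = cnj (sgn (z - 1))"
  define f where "f s = rem_primitive r z (T s)" for s
  define f' where "f' s = of_real (\<nu> * G) *
    ((1 - T s) ^ r * (T s - z) ^ r * T s powr of_real (\<nu> - 1) / T s ^ r) * (z - 1)" for s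
  define \<psi> where "\<psi> s = G * M ^ r * Re (u * T s powr of_real \<nu>)" for s
  define \<psi>' where "\<psi>' s = G * M ^ r * Re (u * (of_real \<nu> * T s powr (of_real \<nu> - 1) * (z - 1)))" for s
  have G: "G > 0" and D: "D > 0" and M: "M \<ge> 0"
    using pochhammer_\<nu>_pos z by (auto simp: G_def D_def M_def)
  have T_pos: "Re (T s) > 0" if "s \<in> {0..1}" for s
    unfolding T_def using segment_Re_ge[OF z, of s] that by simp
  have T_nonpos: "T s \<notin> \<real>\<^sub>\<le>\<^sub>0" if "s \<in> {0..1}" for s
    using T_pos[OF that] by (auto simp: complex_nonpos_Reals_iff)
  have T_deriv: "(T has_vector_derivative (z - 1)) (at s)" for s
    unfolding T_def by (auto intro!: derivative_eq_intros)
  have f_deriv: "(f has_vector_derivative f' s) (at s)" if "s \<in> {0..1}" for s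
    using field_vector_diff_chain_at[OF T_deriv
      rem_primitive_has_field_derivative[OF T_nonpos[OF that], of r z]]
    unfolding f_def f'_def G_def o_def by (simp add: mult_ac)
  have \<psi>_deriv: "(\<psi> has_vector_derivative \<psi>' s) (at s)" if "s \<in> {0..1}" for s
  proof -
    have "((\<lambda>s. T s powr of_real \<nu>) has_vector_derivative
        (z - 1) * (of_real \<nu> * T s powr (of_real \<nu> - 1))) (at s)"
      using field_vector_diff_chain_at[OF T_deriv
        has_field_derivative_powr[OF T_nonpos[OF that], of "of_real \<nu>"]]
      unfolding o_def .
    then have "((\<lambda>s. u * T s powr of_real \<nu>) has_vector_derivative
        u * (of_real \<nu> * T s powr (of_real \<nu> - 1) * (z - 1))) (at s)"
      by (auto intro!: derivative_eq_intros simp: mult_ac)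
    then have "((\<lambda>s. Re (u * T s powr of_real \<nu>)) has_vector_derivative
        Re (u * (of_real \<nu> * T s powr (of_real \<nu> - 1) * (z - 1)))) (at s)"
      by (rule bounded_linear.has_vector_derivative[OF bounded_linear_Re])
    then show ?thesis
      unfolding \<psi>_def \<psi>'_def by (rule has_vector_derivative_mult_right)
  qed
  have u: "u * (z - 1) = of_real \<delta>"
  proof (cases "z = 1")
    case False
    have "u * (z - 1) = cnj (z - 1) * (z - 1) / of_real (cmod (z - 1))"
      by (simp add: u_def sgn_eq)
    also have "cnj (z - 1) * (z - 1) = of_real (cmod (z - 1)) * of_real (cmod (z - 1))"
      by (metis complex_norm_square mult.commute power2_eq_square of_real_mult)
    finally show ?thesis
      using False by (simp add: \<delta>_def norm_minus_commute)
  qed (simp add: \<delta>_def)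
  have bound: "norm (f' s) \<le> \<psi>' s" if s: "0 < s" "s < 1" for s
  proof -
    define q where "q = 4 * s * (1 - s) * D / cmod (T s)"
    have T: "Re (T s) > 0" "cmod (T s) > 0"
      using T_pos[of s] s by auto
    have q: "q \<le> Re (T s) / cmod (T s)" "q \<ge> 0"
      using segment_Re_ge(1)[OF z, of s] s T D unfolding q_def T_def D_def
      by (auto intro!: divide_right_mono)
    have "Re (T s) / cmod (T s) \<le> 1"
      using T complex_Re_le_cmod[of "T s"] by simp
    \<comment> \<open>One factor \<open>q\<close> is enough to supply the missing
      \<open>Re t / |t|\<close>. A positive exponent is essential here, hence the separate case
      \<open>r = 0\<close>.\<close>
    with q have "q ^ r \<le> q"
      unfolding Suc by (simp add: mult_left_le power_le_one)
    have n1: "1 - T s = - (of_real s * (z - 1))" and n2: "T s - z = of_real (1 - s) * (1 - z)"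
      by (simp_all add: T_def algebra_simps)
    have "cmod (1 - T s) = s * \<delta>" "cmod (T s - z) = (1 - s) * \<delta>"
      unfolding n1 n2 using s
      by (simp_all add: norm_mult \<delta>_def norm_minus_commute del: of_real_diff)
    then have "norm (f' s) = \<nu> * G * ((s * \<delta>) ^ r * ((1 - s) * \<delta>) ^ r *
        cmod (T s) powr (\<nu> - 1) / cmod (T s) ^ r) * \<delta>"
      using \<nu> G unfolding f'_def
      by (simp add: norm_mult norm_divide norm_power norm_powr_real_powr' \<delta>_def norm_minus_commute)
    also have "(s * \<delta>) ^ r * ((1 - s) * \<delta>) ^ r * cmod (T s) powr (\<nu> - 1) / cmod (T s) ^ r =
        M ^ r * q ^ r * cmod (T s) powr (\<nu> - 1)"
    proof -
      have "s * \<delta> * ((1 - s) * \<delta>) / cmod (T s) = M * q"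
        using D by (simp add: M_def q_def power2_eq_square)
      then have "(s * \<delta> * ((1 - s) * \<delta>) / cmod (T s)) ^ r = M ^ r * q ^ r"
        by (simp only: power_mult_distrib)
      moreover have "(s * \<delta>) ^ r * ((1 - s) * \<delta>) ^ r * cmod (T s) powr (\<nu> - 1) / cmod (T s) ^ r =
          (s * \<delta> * ((1 - s) * \<delta>) / cmod (T s)) ^ r * cmod (T s) powr (\<nu> - 1)"
        by (simp add: power_mult_distrib power_divide)
      ultimately show ?thesis by (simp only:)
    qed
    also have "\<nu> * G * (M ^ r * q ^ r * cmod (T s) powr (\<nu> - 1)) * \<delta> =
        \<nu> * G * M ^ r * \<delta> * (cmod (T s) powr (\<nu> - 1) * q ^ r)"
      by simp
    also have "\<dots> \<le> \<nu> * G * M ^ r * \<delta> * Re (T s powr of_real (\<nu> - 1))"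
    proof (rule mult_left_mono)
      have "cmod (T s) powr (\<nu> - 1) * q ^ r \<le> cmod (T s) powr (\<nu> - 1) * (Re (T s) / cmod (T s))"
        using \<open>q ^ r \<le> q\<close> q by (intro mult_left_mono) auto
      also have "\<dots> \<le> Re (T s powr of_real (\<nu> - 1))"
        by (rule norm_powr_times_cos_Arg_le[OF T(1)])
      finally show "cmod (T s) powr (\<nu> - 1) * q ^ r \<le> Re (T s powr of_real (\<nu> - 1))" .
      show "0 \<le> \<nu> * G * M ^ r * \<delta>"
        using \<nu> G M by (simp add: \<delta>_def)
    qed
    also have "\<dots> = \<psi>' s"
    proof -
      have "u * (of_real \<nu> * T s powr (of_real \<nu> - 1) * (z - 1)) =
          u * (z - 1) * (of_real \<nu> * T s powr of_real (\<nu> - 1))"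
        by simp
      also have "\<dots> = of_real (\<delta> * \<nu>) * T s powr of_real (\<nu> - 1)"
        unfolding u by simp
      finally have eq: "u * (of_real \<nu> * T s powr (of_real \<nu> - 1) * (z - 1)) =
        of_real (\<delta> * \<nu>) * T s powr of_real (\<nu> - 1)" .
      show ?thesis unfolding \<psi>'_def eq by simp
    qed
    finally show ?thesis .
  qed
  have "norm (f 1 - f 0) \<le> \<psi> 1 - \<psi> 0"
  proof (rule differentiable_bound_general[of 0 1 f \<psi> f' \<psi>'])
    show "continuous_on {0..1} f" "continuous_on {0..1} \<psi>"
      by (intro continuous_at_imp_continuous_on ballI has_vector_derivative_continuous,
        erule f_deriv \<psi>_deriv)+
  qed (use f_deriv \<psi>_deriv bound in auto)
  also have "\<psi> 1 - \<psi> 0 = G * M ^ r * Re (u * (z powr of_real \<nu> - 1))"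
    by (simp add: \<psi>_def T_def algebra_simps)
  also have "\<dots> \<le> G * M ^ r * cmod (1 - z powr of_real \<nu>)"
  proof (rule mult_left_mono)
    have "Re (u * (z powr of_real \<nu> - 1)) \<le> cmod u * cmod (z powr of_real \<nu> - 1)"
      using complex_Re_le_cmod[of "u * (z powr of_real \<nu> - 1)"] by (simp add: norm_mult)
    also have "\<dots> \<le> 1 * cmod (z powr of_real \<nu> - 1)"
      by (intro mult_right_mono) (auto simp: u_def norm_sgn)
    finally show "Re (u * (z powr of_real \<nu> - 1)) \<le> cmod (1 - z powr of_real \<nu>)"
      by (simp add: norm_minus_commute)
  qed (use G M in auto)
  also have "f 1 - f 0 = z powr of_real \<nu> * poly (hyp_rev \<nu> r) z - poly (hyp_poly \<nu> r) z"
  proof -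
    have "z \<noteq> 0" using z by auto
    then show ?thesis
      by (simp add: f_def T_def rem_primitive_at_1 rem_primitive_at_z)
  qed
  finally show ?thesis
    unfolding G_def M_def D_def \<delta>_def by (simp add: mult_ac)
qed

text \<open>Multiplied by \<open>pochhammer (1 - \<nu>) r\<close>, the coefficient is
  \<open>r choose k\<close> times two Pochhammer products. Raising their arguments to the next
  integers yields \<open>fact r * (Suc r choose k)\<close>.\<close>

lemma hyp_coeff_le:
  assumes "k \<le> r"
  shows "hyp_coeff \<nu> r k \<le> fact r / pochhammer (1 - \<nu>) r * real (r choose k) * 2 ^ Suc r"
proof -
  have mono: "pochhammer a j \<le> pochhammer b j" if "0 < a" "a \<le> b" for a b :: real and j
    unfolding pochhammer_prod using that by (intro prod_mono) auto
  have fact_poch: "pochhammer (1 + real i) j = fact (i + j) / fact i" for i j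
    using pochhammer_product'[of "1 :: real" i j] by (simp flip: pochhammer_fact)
  have up: "pochhammer (1 + \<nu>) r = pochhammer (1 + \<nu>) (r - k) * pochhammer (1 + \<nu> + real (r - k)) k"
    using pochhammer_product'[of "1 + \<nu>" "r - k" k] assms by simp
  have down: "pochhammer (1 - \<nu>) r = pochhammer (1 - \<nu>) k * pochhammer (1 - \<nu> + real k) (r - k)"
    using pochhammer_product'[of "1 - \<nu>" k "r - k"] assms by simp
  have "pochhammer (1 + \<nu> + real (r - k)) k \<le> pochhammer (1 + real (Suc (r - k))) k"
    using \<nu> by (intro mono) auto
  then have 1: "pochhammer (1 + \<nu> + real (r - k)) k \<le> fact (Suc r) / fact (Suc (r - k))"
    unfolding fact_poch using assms by simp
  have "pochhammer (1 - \<nu> + real k) (r - k) \<le> pochhammer (1 + real k) (r - k)"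
    using \<nu> by (intro mono) auto
  then have 2: "pochhammer (1 - \<nu> + real k) (r - k) \<le> fact r / fact k"
    unfolding fact_poch using assms by simp
  have "pochhammer (1 + \<nu> + real (r - k)) k * pochhammer (1 - \<nu> + real k) (r - k) \<le>
    fact (Suc r) / fact (Suc (r - k)) * (fact r / fact k)"
    using \<nu> by (intro mult_mono 1 2 less_imp_le[OF pochhammer_pos]) auto
  also have "\<dots> = fact r * real (Suc r choose k)"
    using assms by (simp add: binomial_fact Suc_diff_le mult.commute del: fact_Suc)
  also have "\<dots> \<le> fact r * 2 ^ Suc r"
  proof (rule mult_left_mono)
    have "Suc r choose k \<le> (\<Sum>i\<le>Suc r. Suc r choose i)"
      using assms by (intro member_le_sum) auto
    also have "\<dots> = 2 ^ Suc r" by (rule choose_row_sum)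
    finally show "real (Suc r choose k) \<le> 2 ^ Suc r"
      by (metis of_nat_le_iff of_nat_numeral of_nat_power)
  qed simp
  finally have 3: "pochhammer (1 + \<nu> + real (r - k)) k * pochhammer (1 - \<nu> + real k) (r - k) \<le>
    fact r * 2 ^ Suc r" .
  have "hyp_coeff \<nu> r k * pochhammer (1 - \<nu>) r = real (r choose k) *
    (pochhammer (1 + \<nu> + real (r - k)) k * pochhammer (1 - \<nu> + real k) (r - k))"
    unfolding hyp_coeff_def up down using pochhammer_\<nu>_pos[of k] pochhammer_\<nu>_pos[of "r - k"]
    by simp
  also have "\<dots> \<le> real (r choose k) * (fact r * 2 ^ Suc r)"
    by (intro mult_left_mono 3) simp
  finally show ?thesis
    using pochhammer_\<nu>_pos(2)[of r] by (simp add: field_simps)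
qed

text \<open>The binomial coefficients in the coefficient bound sum to \<open>(1 + |z|) ^ r\<close>.
  The power of \<open>2\<close> in that bound is the origin of the \<open>2\<close> in
  \<open>Q\<close>.\<close>

lemma hyp_poly_bound:
  "cmod (poly (hyp_poly \<nu> r) z) \<le> 2 * (fact r / pochhammer (1 - \<nu>) r) * (2 * (1 + cmod z)) ^ r"
proof -
  define G where "G = fact r / pochhammer (1 - \<nu>) r"
  have "cmod (poly (hyp_poly \<nu> r) z) \<le> (\<Sum>k\<le>r. hyp_coeff \<nu> r k * cmod z ^ k)"
    unfolding poly_hyp_poly
    by (rule order_trans[OF norm_sum]) (simp add: norm_mult norm_power hyp_coeff_nonneg)
  also have "\<dots> \<le> (\<Sum>k\<le>r. G * real (r choose k) * 2 ^ Suc r * cmod z ^ k)"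
    using hyp_coeff_le by (intro sum_mono mult_right_mono) (auto simp: G_def)
  also have "\<dots> = 2 * G * (2 ^ r * (\<Sum>k\<le>r. real (r choose k) * cmod z ^ k * 1 ^ (r - k)))"
    by (simp add: sum_distrib_left mult_ac)
  also have "(\<Sum>k\<le>r. real (r choose k) * cmod z ^ k * 1 ^ (r - k)) = (1 + cmod z) ^ r"
    by (simp only: binomial_ring[symmetric] add.commute)
  finally show ?thesis
    by (simp only: G_def power_mult_distrib)
qed

text \<open>
  The determinant has degree at most \<open>2r + 1\<close> and vanishes at \<open>1\<close> to order at least \<open>2r + 1\<close>,
  by the remainder bound for real \<open>z\<close> near \<open>1\<close>. Hence it is a multiple of \<open>(z - 1)^(2r + 1)\<close>,
  and its value at \<open>0\<close> shows that the factor is not zero.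
\<close>

lemma hyp_determinant_nonzero:
  assumes "z \<noteq> 1"
  shows "poly (hyp_poly \<nu> r) z * poly (hyp_rev \<nu> (Suc r)) z -
    poly (hyp_poly \<nu> (Suc r)) z * poly (hyp_rev \<nu> r) z \<noteq> 0"
proof -
  define D where "D = hyp_poly \<nu> r * hyp_rev \<nu> (Suc r) - hyp_poly \<nu> (Suc r) * hyp_rev \<nu> r"
  define k where "k = Polynomial.order 1 D"
  have D0: "poly D 0 \<noteq> 0"
  proof -
    have "poly (hyp_poly \<nu> i) 0 = 1" for i
      using pochhammer_\<nu>_pos[of i]
      by (simp add: poly_hyp_poly power_0_left sum.atMost_shift hyp_coeff_def)
    moreover have "poly (hyp_rev \<nu> i) 0 = of_real (pochhammer (1 + \<nu>) i / pochhammer (1 - \<nu>) i)" for i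
      by (simp add: poly_hyp_rev power_0_left sum.atMost_shift hyp_coeff_def)
    ultimately have "poly D 0 = of_real (pochhammer (1 + \<nu>) (Suc r) / pochhammer (1 - \<nu>) (Suc r) -
        pochhammer (1 + \<nu>) r / pochhammer (1 - \<nu>) r)"
      by (simp add: D_def)
    also have "pochhammer (1 + \<nu>) (Suc r) / pochhammer (1 - \<nu>) (Suc r) -
        pochhammer (1 + \<nu>) r / pochhammer (1 - \<nu>) r =
      pochhammer (1 + \<nu>) r / pochhammer (1 - \<nu>) r * (2 * \<nu> / (1 - \<nu> + real r))"
    proof -
      define b where "b = 1 - \<nu> + real r"
      have "1 + \<nu> + real r = b + 2 * \<nu>" "b > 0" using \<nu> by (simp_all add: b_def)
      then have "(1 + \<nu> + real r) / (1 - \<nu> + real r) - 1 = 2 * \<nu> / (1 - \<nu> + real r)"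
        unfolding b_def[symmetric] by (simp only: add_divide_distrib) simp
      moreover have "pochhammer (1 + \<nu>) (Suc r) / pochhammer (1 - \<nu>) (Suc r) -
          pochhammer (1 + \<nu>) r / pochhammer (1 - \<nu>) r =
        pochhammer (1 + \<nu>) r / pochhammer (1 - \<nu>) r * ((1 + \<nu> + real r) / (1 - \<nu> + real r) - 1)"
        by (simp add: pochhammer_Suc right_diff_distrib)
      ultimately show ?thesis by (simp only:)
    qed
    finally show ?thesis
      using pochhammer_\<nu>_pos[of r] \<nu> by (simp only: of_real_eq_0_iff) simp
  qed
  then have "D \<noteq> 0" by auto
  obtain q where q: "D = [:- 1, 1:] ^ k * q" "\<not> [:- 1, 1:] dvd q"
    using order_decomp[OF \<open>D \<noteq> 0\<close>, of 1] unfolding k_def by auto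
  have q1: "poly q 1 \<noteq> 0"
    using q(2) by (simp add: poly_eq_0_iff_dvd)
  have degs: "Polynomial.degree (hyp_poly \<nu> i) \<le> i" "Polynomial.degree (hyp_rev \<nu> i) \<le> i" for i
    unfolding hyp_poly_def hyp_rev_def
    by (auto intro!: degree_sum_le order_trans[OF degree_monom_le])
  have degD: "Polynomial.degree D \<le> 2 * r + 1"
    unfolding D_def using degs[of r] degs[of "Suc r"]
    by (intro degree_diff_le order_trans[OF degree_mult_le]) auto
  define R where "R i z = z powr of_real \<nu> * poly (hyp_rev \<nu> i) z - poly (hyp_poly \<nu> i) z" for i z
  define G where "G i = pochhammer (1 + \<nu>) i / fact i" for i
  \<comment> \<open>From \<open>x \<ge> 3 / 4\<close> follows
    \<open>4 * (2 * x - 1) \<ge> 1\<close>, so each of the \<open>i\<close> factors is at most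
    \<open>(1 - x)^2\<close>; \<open>1 - x powr \<nu> \<le> 1 - x\<close> gives the odd one.\<close>
  have R_bound: "cmod (R i (of_real x)) \<le> G i * (1 - x) ^ (2 * i + 1)" if x: "3 / 4 \<le> x" "x < 1" for i x
  proof -
    have norm_1_diff: "cmod (1 - of_real y) = \<bar>1 - y\<bar>" for y
      using norm_of_real[of "1 - y", where 'a = complex] by (simp only: of_real_diff of_real_1)
    have abs: "cmod (1 - of_real x) = 1 - x" "cmod (of_real x) = x"
      using x by (simp_all add: norm_1_diff)
    have "x powr 1 \<le> x powr \<nu>"
      using x \<nu> by (intro powr_mono') auto
    moreover have "x powr \<nu> \<le> 1"
      using x \<nu> by (simp add: powr_le1)
    moreover have "cmod (1 - of_real x powr of_real \<nu>) = \<bar>1 - x powr \<nu>\<bar>"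
      using x by (simp add: powr_of_real norm_1_diff)
    ultimately have 1: "cmod (1 - of_real x powr of_real \<nu>) \<le> 1 - x"
      using x by simp
    have "(1 - x)\<^sup>2 / (4 * (x - (1 - x))) \<le> (1 - x)\<^sup>2 / 1"
      using x by (intro divide_left_mono) auto
    then have 2: "((1 - x)\<^sup>2 / (4 * (x - (1 - x)))) ^ i \<le> ((1 - x)\<^sup>2) ^ i"
      using x by (intro power_mono) auto
    have "cmod (R i (of_real x)) \<le> G i * cmod (1 - of_real x powr of_real \<nu>) *
        ((1 - x)\<^sup>2 / (4 * (x - (1 - x)))) ^ i"
      using hyp_remainder_bound[of "of_real x" i] x unfolding R_def G_def abs by simp
    also have "\<dots> \<le> G i * (1 - x) * ((1 - x)\<^sup>2) ^ i"
      using pochhammer_\<nu>_pos(1)[of i] x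
      by (intro mult_mono 1 2 mult_left_mono) (auto simp: G_def)
    finally show ?thesis
      by (simp add: power_mult)
  qed
  have "k \<ge> 2 * r + 1"
  proof (rule ccontr)
    assume "\<not> k \<ge> 2 * r + 1"
    then have k: "k \<le> 2 * r" by simp
    \<comment> \<open>If \<open>k \<le> 2 * r\<close>, division by \<open>(1 - x) ^ k\<close> leaves
      at least one factor \<open>1 - x\<close>, and \<open>q\<close> would vanish at
      \<open>1\<close>.\<close>
    define B where "B x = (1 - x) * (G (Suc r) * cmod (poly (hyp_rev \<nu> r) (of_real x)) +
      G r * cmod (poly (hyp_rev \<nu> (Suc r)) (of_real x)))" for x
    have qB: "cmod (poly q (of_real x)) \<le> B x" if x: "3 / 4 \<le> x" "x < 1" for x
    proof -
      have G0: "G i > 0" for i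
        using pochhammer_\<nu>_pos by (simp add: G_def)
      \<comment> \<open>The terms with \<open>x powr \<nu>\<close> cancel in this
        combination.\<close>
      have "poly D (of_real x) = R (Suc r) (of_real x) * poly (hyp_rev \<nu> r) (of_real x) -
          R r (of_real x) * poly (hyp_rev \<nu> (Suc r)) (of_real x)"
        by (simp add: D_def R_def algebra_simps)
      then have "cmod (poly D (of_real x)) \<le>
          cmod (R (Suc r) (of_real x)) * cmod (poly (hyp_rev \<nu> r) (of_real x)) +
          cmod (R r (of_real x)) * cmod (poly (hyp_rev \<nu> (Suc r)) (of_real x))"
        by (metis norm_mult norm_triangle_ineq4)
      also have "\<dots> \<le> G (Suc r) * (1 - x) ^ (k + 1) * cmod (poly (hyp_rev \<nu> r) (of_real x)) +
          G r * (1 - x) ^ (k + 1) * cmod (poly (hyp_rev \<nu> (Suc r)) (of_real x))"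
        using x k G0
        by (intro add_mono mult_right_mono order_trans[OF R_bound[OF x]] mult_left_mono power_decreasing)
          (auto intro: less_imp_le)
      also have "\<dots> = (1 - x) ^ k * B x"
        by (simp add: B_def algebra_simps)
      also have "cmod (poly D (of_real x)) = (1 - x) ^ k * cmod (poly q (of_real x))"
      proof -
        have "cmod (of_real x - 1) = 1 - x"
          using x norm_of_real[of "x - 1", where 'a = complex]
          by (simp only: of_real_diff of_real_1)
        then show ?thesis
          unfolding q(1) by (simp add: norm_mult norm_power)
      qed
      finally show ?thesis
        using x by simp
    qed
    have "((\<lambda>x. cmod (poly q (of_real x))) \<longlongrightarrow> cmod (poly q (of_real 1))) (at_left 1)"
      by (intro tendsto_intros)
    moreover have "(B \<longlongrightarrow> (1 - 1) * (G (Suc r) * cmod (poly (hyp_rev \<nu> r) (of_real 1)) +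
      G r * cmod (poly (hyp_rev \<nu> (Suc r)) (of_real 1)))) (at_left 1)"
      unfolding B_def by (intro tendsto_intros)
    moreover have "eventually (\<lambda>x. cmod (poly q (of_real x)) \<le> B x) (at_left 1)"
    proof -
      have "eventually (\<lambda>x :: real. x \<in> {3 / 4<..<1}) (at_left 1)"
        by (rule eventually_at_left_real) simp
      then show ?thesis
        by eventually_elim (use qB in auto)
    qed
    ultimately have "cmod (poly q (of_real 1)) \<le> (1 - 1) * (G (Suc r) * cmod (poly (hyp_rev \<nu> r) (of_real 1)) +
      G r * cmod (poly (hyp_rev \<nu> (Suc r)) (of_real 1)))"
      by (intro tendsto_le[of "at_left (1 :: real)"]) auto
    with q1 show False by simp
  qed
  moreover have "Polynomial.degree D = k + Polynomial.degree q"
    using \<open>D \<noteq> 0\<close> unfolding q(1) by (subst degree_mult_eq) (auto simp: degree_power_eq)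
  ultimately have "Polynomial.degree q = 0"
    using degD by simp
  then obtain a where "q = [:a:]" by (rule degree_eq_zeroE)
  with q1 have "poly q z \<noteq> 0" by simp
  then have "poly D z \<noteq> 0"
    using assms unfolding q(1) by simp
  then show ?thesis
    by (simp add: D_def)
qed

end

section \<open>Denominators of the hypergeometric polynomials\<close>

lemma of_rat_pochhammer: "of_rat (pochhammer x k) = (pochhammer (of_rat x) k :: 'a :: field_char_0)"
  by (induction k) (simp_all add: pochhammer_Suc of_rat_mult of_rat_add)

lemma of_real_of_rat: "of_real (of_rat x) = (of_rat x :: 'a :: real_field)"
  by (cases x) (simp add: of_rat_rat)

text \<open>Both Pochhammer symbols with negative argument carry the sign \<open>(-1) ^ k\<close>,
  so the signs cancel and the coefficient is visibly nonnegative in its other form.\<close>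

lemma hyp_coeff_altdef:
  assumes "0 < \<nu>" "k \<le> r"
  shows "hyp_coeff \<nu> r k = pochhammer (- real r) k * pochhammer (- real r - \<nu>) k /
    (pochhammer (1 - \<nu>) k * fact k)"
proof -
  have 1: "pochhammer (- real r) k = (-1) ^ k * real (r choose k) * fact k"
    using gbinomial_pochhammer[of "real r" k] by (simp add: binomial_gbinomial flip: power_mult_distrib)
  have 2: "pochhammer (- real r - \<nu>) k = (-1) ^ k * pochhammer (1 + \<nu> + real (r - k)) k"
  proof -
    have "- real r - \<nu> = - (real r + \<nu>)" "real r + \<nu> - real k + 1 = 1 + \<nu> + real (r - k)"
      using assms by simp_all
    then show ?thesis
      using pochhammer_minus[of "real r + \<nu>" k] by (simp only:)
  qed
  have 3: "pochhammer (1 + \<nu>) r = pochhammer (1 + \<nu>) (r - k) * pochhammer (1 + \<nu> + real (r - k)) k"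
    using pochhammer_product'[of "1 + \<nu>" "r - k" k] assms by simp
  have "pochhammer (1 + \<nu>) (r - k) > 0"
    using assms by (intro pochhammer_pos) simp
  then show ?thesis
    unfolding hyp_coeff_def 1 2 3 by (simp flip: power_mult_distrib)
qed

lemma coeff_hyp_poly:
  "Polynomial.coeff (hyp_poly \<nu> r) k = (if k \<le> r then of_real (hyp_coeff \<nu> r k) else 0)"
  by (simp add: hyp_poly_def coeff_sum)

lemma degree_X_poly: "Polynomial.degree (X_poly m n r) \<le> r"
  by (rule degree_le) (simp add: X_poly_def coeff_truncate_fps)

lemma map_poly_X_poly:
  assumes "0 < m" "0 < n"
  shows "map_poly of_rat (X_poly m n r) = hyp_poly (real m / real n) r"
proof (rule poly_eqI)
  fix k
  have "of_rat (Polynomial.coeff (X_poly m n r) k) =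
    (if k \<le> r then hyp_coeff (real m / real n) r k else 0)"
  proof (cases "k \<le> r")
    case True
    then have "Polynomial.coeff (X_poly m n r) k =
        pochhammer (- of_nat r) k * pochhammer (- of_nat r - of_nat m / of_nat n) k /
        (pochhammer (1 - of_nat m / of_nat n) k * fact k)"
      by (simp add: X_poly_def coeff_truncate_fps)
    moreover have "of_rat (- of_nat r) = - real r"
      "of_rat (- of_nat r - of_nat m / of_nat n) = - real r - real m / real n"
      "of_rat (1 - of_nat m / of_nat n) = 1 - real m / real n"
      "of_rat (fact k) = (fact k :: real)"
      using of_rat_of_nat_eq[of "fact k", where 'a = real]
      by (simp_all add: of_rat_minus of_rat_diff of_rat_divide)
    ultimately have "of_rat (Polynomial.coeff (X_poly m n r) k) =
        pochhammer (- real r) k * pochhammer (- real r - real m / real n) k /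
        (pochhammer (1 - real m / real n) k * fact k)"
      by (simp only: of_rat_mult of_rat_divide of_rat_pochhammer)
    with True assms show ?thesis by (simp add: hyp_coeff_altdef)
  qed (simp add: X_poly_def coeff_truncate_fps)
  then have "(of_rat (Polynomial.coeff (X_poly m n r) k) :: complex) =
    of_real (if k \<le> r then hyp_coeff (real m / real n) r k else 0)"
    by (metis of_real_of_rat)
  then show "Polynomial.coeff (map_poly of_rat (X_poly m n r)) k =
    Polynomial.coeff (hyp_poly (real m / real n) r) k"
    by (simp add: coeff_map_poly coeff_hyp_poly)
qed

lemma rat_poly_common_denominator:
  fixes p :: "rat poly"
  shows "\<exists>D>0. \<forall>k. of_nat D * Polynomial.coeff p k \<in> \<int>"
proof (induction p)
  case 0
  show ?case by (intro exI[of _ 1]) simp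
next
  case (pCons a p)
  then obtain D where D: "D > 0" "\<And>k. of_nat D * Polynomial.coeff p k \<in> \<int>" by blast
  obtain x y where xy: "quotient_of a = (x, y)" by fastforce
  then have y: "y > 0" and a: "a = of_int x / of_int y"
    using quotient_of_denom_pos quotient_of_div by auto
  define D' where "D' = D * nat y"
  have D': "of_nat D' = (of_nat D * of_int y :: rat)"
    using y by (simp add: D'_def of_nat_nat)
  have "of_nat D' * a = of_nat D * of_int x"
    using y unfolding D' a by simp
  then have "of_nat D' * a \<in> \<int>" by simp
  moreover have "of_nat D' * Polynomial.coeff p k \<in> \<int>" for k
  proof -
    have "of_nat D' * Polynomial.coeff p k = of_int y * (of_nat D * Polynomial.coeff p k)"
      by (simp add: D')
    moreover have "\<dots> \<in> \<int>"
      by (rule Ints_mult[OF Ints_of_int D(2)])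
    ultimately show ?thesis by (simp only:)
  qed
  ultimately have "\<forall>k. of_nat D' * Polynomial.coeff (pCons a p) k \<in> \<int>"
    by (simp add: coeff_pCons split: nat.split)
  moreover have "D' > 0" using D y by (simp add: D'_def)
  ultimately show ?case by blast
qed

lemma X_denom:
  shows "X_denom m n r > 0" and "of_nat (X_denom m n r) * Polynomial.coeff (X_poly m n r) k \<in> \<int>"
  using LeastI_ex[OF rat_poly_common_denominator[of "X_poly m n r"]] unfolding X_denom_def by auto

text \<open>Lets the denominator of \<open>X_poly\<close> also serve after the substitution of
  \<open>1 - d * x\<close>.\<close>

lemma coeff_pcompose_mem_Ints:
  assumes "\<And>k. Polynomial.coeff p k \<in> \<int>" "\<And>k. Polynomial.coeff q k \<in> \<int>"
  shows "Polynomial.coeff (pcompose p q) k \<in> \<int>"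
  using assms(1)
proof (induction p arbitrary: k)
  case (pCons a p)
  have "a \<in> \<int>" "\<And>k. Polynomial.coeff p k \<in> \<int>"
    using pCons.prems[of 0] pCons.prems[of "Suc k" for k] by auto
  with pCons.IH have "Polynomial.coeff (pcompose p q) k \<in> \<int>" for k by blast
  with \<open>a \<in> \<int>\<close> show ?case
    using assms(2) by (auto simp: pcompose_pCons coeff_mult coeff_pCons split: nat.split intro!: Ints_add Ints_sum Ints_mult)
qed simp

text \<open>In lowest terms \<open>c = x / y\<close>, integrality of \<open>D * c\<close> forces
  \<open>y dvd D\<close>; the product is then \<open>(D / y) * (x / N)\<close>.\<close>

lemma mult_denom_div_numer_gcd_mem_Ints:
  fixes c :: rat
  assumes "of_nat D * c \<in> \<int>" "N dvd fst (quotient_of c)" "N > 0"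
  shows "of_nat D / of_int N * c \<in> \<int>"
proof -
  obtain x y where xy: "quotient_of c = (x, y)" by fastforce
  then have y: "y > 0" and c: "c = of_int x / of_int y" and cop: "coprime x y"
    using quotient_of_denom_pos quotient_of_div quotient_of_coprime by auto
  obtain k where "of_nat D * c = of_int k" using assms(1) by (rule Ints_cases)
  then have "(of_int (int D * x) :: rat) = of_int (k * y)"
    using y unfolding c by (simp add: field_simps)
  then have "int D * x = k * y" by (simp only: of_int_eq_iff)
  then have "y dvd int D * x" by simp
  with cop have "y dvd int D" by (simp add: coprime_commute coprime_dvd_mult_left_iff)
  then obtain a where a: "int D = y * a" by blast
  obtain b where b: "x = N * b" using assms(2) xy by auto
  have "of_nat D = (of_int y * of_int a :: rat)"
    using arg_cong[OF a, of "of_int :: int \<Rightarrow> rat"] by simp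
  then have "of_nat D / of_int N * c = of_int (a * b)"
    using y \<open>N > 0\<close> unfolding c b by simp
  then show ?thesis by (simp only: Ints_of_int)
qed

lemma X_numer_gcd_pos:
  assumes "d > 0"
  shows "X_numer_gcd m n d r > 0"
proof -
  define p where "p = pcompose (X_poly m n r) [:1, - of_nat d:]"
  \<comment> \<open>The substitution sends \<open>1 / d\<close> to \<open>0\<close>, where
    \<open>X_poly\<close> is \<open>1\<close>; only the zero polynomial would have numerator gcd
    \<open>0\<close>.\<close>
  have "poly p (1 / of_nat d) = Polynomial.coeff (X_poly m n r) 0"
    using assms by (simp add: p_def poly_pcompose poly_0_coeff_0)
  also have "\<dots> = 1"
    by (simp add: X_poly_def coeff_truncate_fps)
  finally have "p \<noteq> 0" by auto
  then obtain k where k: "Polynomial.coeff p k \<noteq> 0"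
    using leading_coeff_0_iff by blast
  then have "fst (quotient_of (Polynomial.coeff p k)) \<noteq> 0"
    by (metis div_0 eq_fst_iff of_int_0 quotient_of_div)
  then have "X_numer_gcd m n d r \<noteq> 0"
    unfolding X_numer_gcd_def p_def[symmetric] by auto
  moreover have "X_numer_gcd m n d r \<ge> 0"
    unfolding X_numer_gcd_def by simp
  ultimately show ?thesis by simp
qed

lemma algebraic_int_scaled_X_poly:
  fixes a b g :: complex
  assumes "0 < m" "0 < n" "d > 0" "b \<noteq> 0" "g \<noteq> 0"
    and "algebraic_int (b / g)" "algebraic_int ((b - a) / (of_nat d * g))"
  shows "algebraic_int (of_nat (X_denom m n r) / of_int (X_numer_gcd m n d r) *
    (b ^ r * poly (hyp_poly (real m / real n) r) (a / b)) / g ^ r)"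
proof -
  define D N where "D = X_denom m n r" and "N = X_numer_gcd m n d r"
  define l :: "rat poly" where "l = [:1, - of_nat d:]"
  define p where "p = pcompose (X_poly m n r) l"
  \<comment> \<open>Chosen so that \<open>1 - d * x = a / b\<close> and
    \<open>x * (b / g) = (b - a) / (d * g)\<close>; each power of \<open>x\<close> uses up one
    factor \<open>b / g\<close>.\<close>
  define x where "x = (b - a) / (of_nat d * b)"
  have N: "N > 0" unfolding N_def by (rule X_numer_gcd_pos) fact
  have l_int: "Polynomial.coeff l k \<in> \<int>" for k
    by (simp add: l_def coeff_pCons split: nat.split)
  have Dp: "of_nat D * Polynomial.coeff p k \<in> \<int>" for k
  proof -
    have "Polynomial.coeff (pcompose (Polynomial.smult (of_nat D) (X_poly m n r)) l) k \<in> \<int>"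
      using X_denom(2)[of m n r] by (intro coeff_pcompose_mem_Ints l_int) (simp add: D_def)
    then show ?thesis by (simp add: p_def pcompose_smult)
  qed
  have coeff_int: "of_nat D / of_int N * Polynomial.coeff p k \<in> \<int>" for k
  proof (rule mult_denom_div_numer_gcd_mem_Ints[OF Dp _ N])
    show "N dvd fst (quotient_of (Polynomial.coeff p k))"
      unfolding N_def X_numer_gcd_def p_def l_def by (intro Gcd_dvd) simp
  qed
  have deg: "Polynomial.degree p \<le> r"
    unfolding p_def l_def using degree_X_poly[of m n r]
    by (intro order_trans[OF degree_pcompose_le]) simp
  have "poly (map_poly of_rat p) x = poly (hyp_poly (real m / real n) r) (poly (map_poly of_rat l) x)"
    using assms unfolding p_def of_rat_hom.map_poly_pcompose
    by (simp add: poly_pcompose map_poly_X_poly)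
  also have "map_poly of_rat l = [:1, - of_nat d:]"
    by (rule poly_eqI) (simp add: l_def coeff_map_poly coeff_pCons of_rat_minus split: nat.split)
  also have "poly [:1, - of_nat d:] x = 1 - of_nat d * x"
    by simp
  also have "\<dots> = a / b"
  proof -
    have "of_nat d * x = (b - a) / b"
      using assms by (simp add: x_def)
    then show ?thesis
      using assms by (simp add: diff_divide_distrib)
  qed
  finally have "poly (map_poly of_rat p) x = poly (hyp_poly (real m / real n) r) (a / b)" .
  then have eval: "poly (hyp_poly (real m / real n) r) (a / b) = (\<Sum>k\<le>r. of_rat (Polynomial.coeff p k) * x ^ k)"
  proof -
    have "Polynomial.degree (map_poly of_rat p :: complex poly) \<le> r"
      using deg degree_map_poly_le order_trans by blast
    then have "poly (map_poly of_rat p) x = (\<Sum>k\<le>r. Polynomial.coeff (map_poly of_rat p) k * x ^ k)"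
      unfolding poly_altdef by (intro sum.mono_neutral_left) (auto simp: coeff_eq_0)
    with \<open>poly (map_poly of_rat p) x = poly (hyp_poly (real m / real n) r) (a / b)\<close> show ?thesis
      by (simp add: coeff_map_poly)
  qed
  have summand: "of_nat D / of_int N * (of_rat (Polynomial.coeff p k) * x ^ k) * (b / g) ^ r =
      of_rat (of_nat D / of_int N * Polynomial.coeff p k) *
        (((b - a) / (of_nat d * g)) ^ k * (b / g) ^ (r - k))" if "k \<le> r" for k
  proof -
    have "x ^ k * (b / g) ^ r = (x * (b / g)) ^ k * (b / g) ^ (r - k)"
    proof -
      have "(b / g) ^ r = (b / g) ^ k * (b / g) ^ (r - k)"
        using that by (simp flip: power_add)
      then show ?thesis by (simp only: power_mult_distrib mult.assoc)
    qed
    also have "x * (b / g) = (b - a) / (of_nat d * g)"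
      using assms by (simp add: x_def)
    finally show ?thesis
      by (simp add: of_rat_mult of_rat_divide mult.assoc)
  qed
  have "of_nat D / of_int N * (b ^ r * poly (hyp_poly (real m / real n) r) (a / b)) / g ^ r =
    (\<Sum>k\<le>r. of_nat D / of_int N * (of_rat (Polynomial.coeff p k) * x ^ k) * (b / g) ^ r)"
    unfolding eval by (simp add: sum_distrib_left sum_distrib_right power_divide mult_ac sum_divide_distrib)
  also have "\<dots> = (\<Sum>k\<le>r. of_rat (of_nat D / of_int N * Polynomial.coeff p k) *
        (((b - a) / (of_nat d * g)) ^ k * (b / g) ^ (r - k)))"
    by (intro sum.cong refl) (simp only: summand atMost_iff)
  also have "algebraic_int \<dots>"
  proof (intro algebraic_int_sum algebraic_int_mult algebraic_int_power assms)
    fix k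
    obtain j where "of_nat D / of_int N * Polynomial.coeff p k = of_int j"
      using coeff_int by (rule Ints_cases)
    then show "algebraic_int (of_rat (of_nat D / of_int N * Polynomial.coeff p k) :: complex)"
      by simp
  qed
  finally show ?thesis unfolding D_def N_def .
qed

section \<open>Quadratic extensions of imaginary quadratic fields\<close>

lemma C_field_sel [simp]:
  "carrier C_field = UNIV" "x \<otimes>\<^bsub>C_field\<^esub> y = x * y" "x \<oplus>\<^bsub>C_field\<^esub> y = x + y"
  "\<zero>\<^bsub>C_field\<^esub> = 0" "\<one>\<^bsub>C_field\<^esub> = 1"
  by (simp_all add: ring_of_type_algebra_def)

lemma C_field_a_inv [simp]: "\<ominus>\<^bsub>C_field\<^esub> x = - x"
proof -
  interpret C: Ring.field C_field by (rule field_from_type_algebra)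
  have "x \<oplus>\<^bsub>C_field\<^esub> (\<ominus>\<^bsub>C_field\<^esub> x) = \<zero>\<^bsub>C_field\<^esub>"
    by (rule C.r_neg) simp
  then show ?thesis by (simp add: add_eq_0_iff)
qed

lemma C_field_m_inv: "x \<noteq> 0 \<Longrightarrow> inv\<^bsub>C_field\<^esub> x = inverse x"
proof -
  interpret C: Ring.field C_field by (rule field_from_type_algebra)
  assume "x \<noteq> 0"
  then show "inv\<^bsub>C_field\<^esub> x = inverse x"
    by (intro C.comm_inv_char) auto
qed

locale complex_subfield =
  fixes F :: "complex set"
  assumes subfield_C_field: "subfield F C_field"
begin

lemma zero_mem [simp]: "0 \<in> F" and one_mem [simp]: "1 \<in> F"
  and minus_mem: "x \<in> F \<Longrightarrow> - x \<in> F"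
  and mult_mem: "x \<in> F \<Longrightarrow> y \<in> F \<Longrightarrow> x * y \<in> F"
  and add_mem: "x \<in> F \<Longrightarrow> y \<in> F \<Longrightarrow> x + y \<in> F"
  using subringE[OF subfieldE(1)[OF subfield_C_field]] by auto

lemma inverse_mem: "x \<in> F \<Longrightarrow> inverse x \<in> F"
proof -
  interpret C: Ring.field C_field by (rule field_from_type_algebra)
  assume "x \<in> F"
  then show ?thesis
    using C.subfield_m_inv(1)[OF subfield_C_field, of x] by (cases "x = 0") (auto simp: C_field_m_inv)
qed

lemma diff_mem: "x \<in> F \<Longrightarrow> y \<in> F \<Longrightarrow> x - y \<in> F"
  using add_mem[of x "- y"] minus_mem by simp

lemma divide_mem: "x \<in> F \<Longrightarrow> y \<in> F \<Longrightarrow> x / y \<in> F"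
  unfolding divide_inverse by (intro mult_mem inverse_mem)

lemma power_mem: "x \<in> F \<Longrightarrow> x ^ k \<in> F"
  by (induction k) (auto intro: mult_mem)

lemma sum_mem: "(\<And>i. i \<in> I \<Longrightarrow> f i \<in> F) \<Longrightarrow> sum f I \<in> F"
  by (induction I rule: infinite_finite_induct) (auto intro: add_mem)

lemma of_nat_mem: "of_nat k \<in> F"
  by (induction k) (auto intro: add_mem)

lemma of_int_mem: "of_int k \<in> F"
  by (cases k) (auto intro: of_nat_mem minus_mem simp del: of_nat_Suc)

lemma Rats_subset: "\<rat> \<subseteq> F"
proof
  fix x :: complex assume "x \<in> \<rat>"
  then obtain a b :: int where "x = of_int a / of_int b"
    by (rule Rats_cases')
  then show "x \<in> F" by (auto intro: divide_mem of_int_mem)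
qed

end

lemma subfield_C_fieldI:
  assumes "1 \<in> F" "\<And>x. x \<in> F \<Longrightarrow> - x \<in> F" "\<And>x y. x \<in> F \<Longrightarrow> y \<in> F \<Longrightarrow> x + y \<in> F"
    "\<And>x y. x \<in> F \<Longrightarrow> y \<in> F \<Longrightarrow> x * y \<in> F" "\<And>x. x \<in> F \<Longrightarrow> x \<noteq> 0 \<Longrightarrow> inverse x \<in> F"
  shows "subfield F C_field"
proof -
  interpret C: Ring.field C_field by (rule field_from_type_algebra)
  have "subring F C_field"
    using assms by (intro C.subringI) auto
  then show ?thesis
    using assms by (intro C.subfieldI') (auto simp: C_field_m_inv)
qed

lemma complex_subfield_Rats: "complex_subfield \<rat>"
  by (rule complex_subfield.intro, rule subfield_C_fieldI) (auto simp: Rats_inverse)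

text \<open>\<open>K + K w\<close> is already a field, with inverses obtained from the conjugate
  \<open>a - b * w\<close>; if that conjugate vanishes, the element is \<open>a + a\<close> and lies
  in \<open>K\<close>.\<close>

lemma generate_field_square_root:
  assumes K: "subfield K C_field" and w: "w\<^sup>2 \<in> K" and x: "x \<in> generate_field C_field (insert w K)"
  shows "\<exists>a\<in>K. \<exists>b\<in>K. x = a + b * w"
proof -
  interpret C: Ring.field C_field by (rule field_from_type_algebra)
  interpret K: complex_subfield K by (rule complex_subfield.intro[OF K])
  define E where "E = {a + b * w | a b. a \<in> K \<and> b \<in> K}"
  have E: "a + b * w \<in> E" if "a \<in> K" "b \<in> K" for a b
    using that by (auto simp: E_def)
  have KE: "a \<in> E" if "a \<in> K" for a
    using E[of a 0] that by simp
  have "subfield E C_field"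
  proof (rule subfield_C_fieldI)
    show "1 \<in> E" by (simp add: KE)
  next
    fix x assume "x \<in> E"
    then obtain a b where "a \<in> K" "b \<in> K" "x = a + b * w" by (auto simp: E_def)
    then show "- x \<in> E" using E[of "- a" "- b"] by (simp add: K.minus_mem)
  next
    fix x y assume "x \<in> E" "y \<in> E"
    then obtain a b a' b' where ab: "a \<in> K" "b \<in> K" "x = a + b * w" "a' \<in> K" "b' \<in> K" "y = a' + b' * w"
      by (auto simp: E_def)
    show "x + y \<in> E"
      using E[of "a + a'" "b + b'"] ab by (simp add: K.add_mem algebra_simps)
    have "x * y = (a * a' + b * b' * w\<^sup>2) + (a * b' + b * a') * w"
      using ab by (simp add: algebra_simps power2_eq_square)
    then show "x * y \<in> E"
      using E[of "a * a' + b * b' * w\<^sup>2" "a * b' + b * a'"] ab w by (simp add: K.add_mem K.mult_mem)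
  next
    fix x assume "x \<in> E" "x \<noteq> 0"
    then obtain a b where ab: "a \<in> K" "b \<in> K" "x = a + b * w" by (auto simp: E_def)
    show "inverse x \<in> E"
    proof (cases "a = b * w")
      case True
      then have "inverse x = inverse (a + a)" using ab by simp
      moreover have "inverse (a + a) \<in> E" using ab by (intro KE K.inverse_mem K.add_mem)
      ultimately show ?thesis by (simp only:)
    next
      case False
      define N where "N = a\<^sup>2 - b\<^sup>2 * w\<^sup>2"
      have N: "N = x * (a - b * w)"
        using ab by (simp add: N_def algebra_simps power2_eq_square)
      have "inverse x = a / N + (- b / N) * w"
      proof -
        have "inverse x = (a - b * w) / N"
          using \<open>x \<noteq> 0\<close> False unfolding N by (simp add: inverse_eq_divide)
        then show ?thesis by (simp add: diff_divide_distrib)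
      qed
      moreover have N_mem: "N \<in> K"
        unfolding N_def by (intro K.diff_mem K.power_mem ab K.mult_mem[OF _ w])
      moreover have "a / N + (- b / N) * w \<in> E"
        using ab N_mem by (intro E K.divide_mem K.minus_mem)
      ultimately show ?thesis by (simp only:)
    qed
  qed
  moreover have "insert w K \<subseteq> E"
    using KE E[of 0 1] by auto
  ultimately have "generate_field C_field (insert w K) \<subseteq> E"
    by (intro C.generate_field_min_subfield1) auto
  with x show ?thesis unfolding E_def by blast
qed

lemma complex_Rats_subset_Reals: "\<rat> \<subseteq> (\<real> :: complex set)"
  by (auto elim!: Rats_cases')

text \<open>Two independent elements span a space of dimension \<open>2\<close>; a non-real
  \<open>y\<close> is not a rational multiple of \<open>1\<close>.\<close>

lemma imaginary_quadratic_field_basis: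
  assumes "imaginary_quadratic_field K"
  obtains y where "y \<in> K" "y \<notin> \<real>" "\<And>x. x \<in> K \<Longrightarrow> \<exists>a\<in>\<rat>. \<exists>b\<in>\<rat>. x = a + b * y"
proof -
  interpret C: Ring.field C_field by (rule field_from_type_algebra)
  have K: "subfield K C_field" "ring.dimension C_field 2 \<rat> K" "\<not> K \<subseteq> \<real>"
    using assms by (auto simp: imaginary_quadratic_field_def)
  interpret K: complex_subfield K by (rule complex_subfield.intro[OF K(1)])
  interpret Q: complex_subfield \<rat> by (rule complex_subfield_Rats)
  obtain y where y: "y \<in> K" "y \<notin> \<real>" using K by auto
  have span1: "C.Span \<rat> [1] = \<rat>"
    by (auto simp: C.line_extension_mem_iff)
  have "C.independent \<rat> [y, 1]"
  proof (intro C.li_Cons)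
    show "y \<notin> C.Span \<rat> [1]"
      using y complex_Rats_subset_Reals unfolding span1 by auto
  qed auto
  then have "C.Span \<rat> [y, 1] = K"
    using C.independent_length_eq_dimension[OF Q.subfield_C_field K(2), of "[y, 1]"] y by auto
  moreover have "C.Span \<rat> [y, 1] = C.line_extension \<rat> y \<rat>"
    using span1 by simp
  ultimately have "\<exists>a\<in>\<rat>. \<exists>b\<in>\<rat>. x = a + b * y" if "x \<in> K" for x
    using that by (fastforce simp: C.line_extension_mem_iff add.commute)
  with y that show thesis by blast
qed

text \<open>\<open>x * cnj x\<close> is a rational algebraic integer, hence an integer, and it is
  positive.\<close>

lemma imaginary_quadratic_field_norm_ge_1:
  assumes K: "imaginary_quadratic_field K" and x: "x \<in> K" "algebraic_int x" "x \<noteq> 0"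
  shows "cmod x \<ge> 1"
proof -
  interpret K: complex_subfield K
    using K by (intro complex_subfield.intro) (simp add: imaginary_quadratic_field_def)
  obtain y where y: "y \<in> K" "y \<notin> \<real>" and basis: "\<And>x. x \<in> K \<Longrightarrow> \<exists>a\<in>\<rat>. \<exists>b\<in>\<rat>. x = a + b * y"
    using imaginary_quadratic_field_basis[OF K] by metis
  have Rats_cnj: "cnj a = a" if "a \<in> \<rat>" for a
    using that complex_Rats_subset_Reals by (auto simp: Reals_cnj_iff)
  obtain a b where ab: "a \<in> \<rat>" "b \<in> \<rat>" "y\<^sup>2 = a + b * y"
    using basis[OF K.power_mem[OF y(1)]] by blast
  \<comment> \<open>\<open>y\<close> and \<open>cnj y\<close> are distinct roots of one quadratic
    with rational coefficients, so their sum and product are rational.\<close>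
  have "cnj y ^ 2 = a + b * cnj y"
    using arg_cong[OF ab(3), of cnj] ab(1,2) by (simp add: Rats_cnj)
  then have "(y - cnj y) * (y + cnj y - b) = 0"
    using ab(3) by (simp add: algebra_simps power2_eq_square)
  moreover have "y - cnj y \<noteq> 0"
    using y by (auto simp: Reals_cnj_iff)
  ultimately have tr: "y + cnj y = b" by auto
  have nm: "y * cnj y = - a"
    using ab(3) unfolding tr[symmetric] by (simp add: algebra_simps power2_eq_square eq_neg_iff_add_eq_0)
  obtain p q where pq: "p \<in> \<rat>" "q \<in> \<rat>" "x = p + q * y"
    using basis x by blast
  have "x * cnj x = p\<^sup>2 + p * q * (y + cnj y) + q\<^sup>2 * (y * cnj y)"
    using pq by (simp add: Rats_cnj algebra_simps power2_eq_square)
  also have "\<dots> \<in> \<rat>"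
    unfolding tr nm using ab pq by simp
  finally have "x * cnj x \<in> \<rat>" .
  moreover have "algebraic_int (x * cnj x)"
    using x by (intro algebraic_int_mult) auto
  ultimately have "x * cnj x \<in> \<int>"
    by (intro rational_algebraic_int_is_int)
  then obtain k :: int where "x * cnj x = of_int k" by (rule Ints_cases)
  then have "complex_of_real ((cmod x)\<^sup>2) = of_real (of_int k)"
    by (simp only: complex_norm_square of_real_of_int_eq)
  then have k: "(cmod x)\<^sup>2 = of_int k"
    by (simp only: of_real_eq_iff)
  moreover have "(cmod x)\<^sup>2 > 0" using x by simp
  ultimately have "k \<ge> 1" by simp
  then have "(cmod x)\<^sup>2 \<ge> 1\<^sup>2" using k by simp
  then show ?thesis by (rule power2_le_imp_le) simp
qed

text \<open>Reduces the quadratic extension to \<open>L = K + K w\<close> with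
  \<open>\<sigma> w = - w\<close>; \<open>w\<close> will be the square root of \<tau>.\<close>

locale complex_involution =
  K: complex_subfield K + L: complex_subfield L for K L :: "complex set" +
  fixes \<sigma> :: "complex \<Rightarrow> complex" and w :: complex
  assumes K_subset_L: "K \<subseteq> L"
    and \<sigma>_mem: "x \<in> L \<Longrightarrow> \<sigma> x \<in> L"
    and \<sigma>_add: "x \<in> L \<Longrightarrow> y \<in> L \<Longrightarrow> \<sigma> (x + y) = \<sigma> x + \<sigma> y"
    and \<sigma>_mult: "x \<in> L \<Longrightarrow> y \<in> L \<Longrightarrow> \<sigma> (x * y) = \<sigma> x * \<sigma> y"
    and \<sigma>_fix: "x \<in> K \<Longrightarrow> \<sigma> x = x"
    and w_nonzero: "w \<noteq> 0" and w_square: "w\<^sup>2 \<in> K" and w_mem: "w \<in> L" and \<sigma>_w: "\<sigma> w = - w"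
    and L_decomp: "x \<in> L \<Longrightarrow> \<exists>a\<in>K. \<exists>b\<in>K. x = a + b * w"
begin

lemma \<sigma>_decomp:
  assumes "a \<in> K" "b \<in> K"
  shows "\<sigma> (a + b * w) = a - b * w"
  using assms K_subset_L by (simp add: \<sigma>_add \<sigma>_mult \<sigma>_fix L.mult_mem w_mem \<sigma>_w subset_iff)

lemma \<sigma>_involutive:
  assumes "x \<in> L"
  shows "\<sigma> (\<sigma> x) = x"
proof -
  obtain a b where "a \<in> K" "b \<in> K" "x = a + b * w" using L_decomp assms by blast
  then show ?thesis
    using \<sigma>_decomp[of a b] \<sigma>_decomp[of a "- b"] by (simp add: K.minus_mem)
qed

lemma trace_mem:
  assumes "x \<in> L"
  shows "x + \<sigma> x \<in> K"
proof -
  obtain a b where ab: "a \<in> K" "b \<in> K" "x = a + b * w" using L_decomp assms by blast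
  then have "x + \<sigma> x = a + a" by (simp add: \<sigma>_decomp)
  moreover have "a + a \<in> K" using ab by (intro K.add_mem)
  ultimately show ?thesis by (simp only:)
qed

text \<open>\<open>x - \<sigma> x\<close> is \<open>w\<close> times an element of \<open>K\<close>,
  and another \<open>w\<close> brings it into \<open>K\<close>. This handles the minus sign in the
  definition of \<alpha>.\<close>

lemma antitrace_mem:
  assumes "x \<in> L"
  shows "w * (x - \<sigma> x) \<in> K"
proof -
  obtain a b where ab: "a \<in> K" "b \<in> K" "x = a + b * w" using L_decomp assms by blast
  then have "w * (x - \<sigma> x) = (b + b) * w\<^sup>2"
    by (simp add: \<sigma>_decomp algebra_simps power2_eq_square)
  moreover have "(b + b) * w\<^sup>2 \<in> K" using ab w_square by (intro K.add_mem K.mult_mem)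
  ultimately show ?thesis by (simp only:)
qed

lemma \<sigma>_power: "x \<in> L \<Longrightarrow> \<sigma> (x ^ k) = \<sigma> x ^ k"
  by (induction k) (simp_all add: \<sigma>_mult L.power_mem \<sigma>_fix)

lemma \<sigma>_sum: "(\<And>i. i \<in> I \<Longrightarrow> f i \<in> L) \<Longrightarrow> \<sigma> (sum f I) = (\<Sum>i\<in>I. \<sigma> (f i))"
  by (induction I rule: infinite_finite_induct) (simp_all add: \<sigma>_fix \<sigma>_add L.sum_mem)

lemma \<sigma>_rat: "x \<in> \<rat> \<Longrightarrow> \<sigma> x = x"
  using K.Rats_subset \<sigma>_fix by blast

text \<open>\<sigma> fixes the integer coefficients of a monic equation and so permits no other
  equation for the image.\<close>

lemma algebraic_int_\<sigma>:
  assumes "x \<in> L" "algebraic_int x"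
  shows "algebraic_int (\<sigma> x)"
proof -
  obtain p :: "complex poly" where p: "Polynomial.lead_coeff p = 1" "\<And>i. Polynomial.coeff p i \<in> \<int>" "poly p x = 0"
    using assms(2) by (auto elim!: algebraic_int.cases)
  have c: "Polynomial.coeff p i \<in> \<rat>" for i
    using p(2) Ints_subset_Rats by blast
  have mem: "Polynomial.coeff p i * x ^ i \<in> L" for i
    using c L.Rats_subset assms(1) by (auto intro!: L.mult_mem L.power_mem)
  have "poly p (\<sigma> x) = (\<Sum>i\<le>Polynomial.degree p. \<sigma> (Polynomial.coeff p i * x ^ i))"
    unfolding poly_altdef using assms(1) c L.Rats_subset
    by (intro sum.cong refl) (simp add: \<sigma>_mult L.power_mem \<sigma>_power \<sigma>_rat subset_iff)
  also have "\<dots> = \<sigma> (poly p x)"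
    unfolding poly_altdef using mem by (simp add: \<sigma>_sum)
  finally have "poly p (\<sigma> x) = 0"
    using p(3) by (simp add: \<sigma>_fix)
  with p show ?thesis by (intro algebraic_int.intros) auto
qed

end

lemma complex_involutionI:
  assumes K: "subfield K C_field" and L: "subfield L C_field" "K \<subseteq> L"
    and \<sigma>: "\<sigma> \<in> Galois_group L K" "\<exists>x\<in>L. \<sigma> x \<noteq> x"
    and w: "w\<^sup>2 \<in> K" "L = generate_field C_field (insert w K)"
  shows "complex_involution K L \<sigma> w"
proof -
  interpret K: complex_subfield K by (rule complex_subfield.intro[OF K])
  interpret L: complex_subfield L by (rule complex_subfield.intro[OF L(1)])
  have hom: "\<sigma> \<in> Ring.ring_hom (C_field\<lparr>carrier := L\<rparr>) (C_field\<lparr>carrier := L\<rparr>)" and fix_K: "\<And>x. x \<in> K \<Longrightarrow> \<sigma> x = x"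
    using \<sigma> by (auto simp: Galois_group_def ring_iso_def)
  have mem: "\<sigma> x \<in> L" if "x \<in> L" for x
    using ring_hom_closed[OF hom, of x] that by simp
  have mult: "\<sigma> (x * y) = \<sigma> x * \<sigma> y" if "x \<in> L" "y \<in> L" for x y
    using ring_hom_mult[OF hom, of x y] that by simp
  have add: "\<sigma> (x + y) = \<sigma> x + \<sigma> y" if "x \<in> L" "y \<in> L" for x y
    using ring_hom_add[OF hom, of x y] that by simp
  have wL: "w \<in> L"
    unfolding w(2) by (rule generate_field.incl) simp
  have decomp: "\<exists>a\<in>K. \<exists>b\<in>K. x = a + b * w" if "x \<in> L" for x
    using generate_field_square_root[OF K w(1)] that w(2) by blast
  \<comment> \<open>Otherwise \<sigma> would fix \<open>K + K w\<close>, that is, all of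
    \<open>L\<close>.\<close>
  have "\<sigma> w \<noteq> w"
  proof
    assume fix_w: "\<sigma> w = w"
    obtain x where x: "x \<in> L" "\<sigma> x \<noteq> x" using \<sigma> by blast
    then obtain a b where ab: "a \<in> K" "b \<in> K" "x = a + b * w" using decomp by blast
    then have "a \<in> L" "b \<in> L" using L by auto
    then have "\<sigma> x = x"
      using ab wL by (simp add: add mult fix_K fix_w L.mult_mem)
    with x show False by simp
  qed
  have "\<sigma> w * \<sigma> w = w * w"
    using mult[OF wL wL] fix_K[OF w(1)] by (simp add: power2_eq_square)
  then have "(\<sigma> w - w) * (\<sigma> w + w) = 0"
    by (simp add: algebra_simps)
  with \<open>\<sigma> w \<noteq> w\<close> have "\<sigma> w = - w"
    by (simp add: eq_neg_iff_add_eq_0)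
  moreover from this \<open>\<sigma> w \<noteq> w\<close> have "w \<noteq> 0" by auto
  ultimately show ?thesis
    by (intro complex_involution.intro K.complex_subfield_axioms L.complex_subfield_axioms
        complex_involution_axioms.intro)
      (use L mem mult add fix_K wL decomp w in auto)
qed

section \<open>The irrationality measure\<close>

text \<open>A nonzero \<open>a * q r - p r * b\<close> has absolute value at least \<open>1\<close>
  and equals \<open>b * (q r * \<alpha> - p r) - q r * (b * \<alpha> - a)\<close>. Near the least
  index at which the bound for the first term drops to \<open>1 / 2\<close>, the second term has
  absolute value at least \<open>1 / 2\<close>, and the bound for \<open>q r\<close> finishes the
  estimate.\<close>

lemma irrationality_measure_from_approximations:
  fixes \<alpha> a b :: complex and p q :: "nat \<Rightarrow> complex"
  assumes lin: "\<And>r. a * q r - p r * b \<noteq> 0 \<Longrightarrow> 1 \<le> cmod (a * q r - p r * b)"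
    and q_int: "\<And>r. q r \<noteq> 0 \<Longrightarrow> 1 \<le> cmod (q r)" and b: "1 \<le> cmod b"
    and det: "\<And>r. p r * q (Suc r) \<noteq> p (Suc r) * q r"
    and q_bound: "\<And>r. cmod (q r) < k0 * Q ^ r"
    and rem_bound: "\<And>r. cmod (q r * \<alpha> - p r) \<le> l0 * (1 / E) ^ r"
    and E: "E > 1" and Q: "Q > 0" and l0: "l0 \<ge> 0"
  shows "1 / (2 * k0 * Q * max E (2 * l0 * E) powr (ln Q / ln E) * cmod b powr (ln Q / ln E + 1)) <
    cmod (\<alpha> - a / b)"
proof -
  define \<kappa> M err where "\<kappa> = ln Q / ln E" and "M = max E (2 * l0 * E)" and "err = cmod (\<alpha> - a / b)"
  have k0: "k0 > 0"
    using le_less_trans[OF norm_ge_zero q_bound[of 0]] by simp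
  have b0: "b \<noteq> 0" using b by auto
  \<comment> \<open>If \<open>Q < 1\<close>, the integers \<open>q r\<close> would vanish for all large \<open>r\<close>, contradicting \<open>det\<close>.\<close>
  have Q1: "Q \<ge> 1"
  proof (rule ccontr)
    assume "\<not> Q \<ge> 1"
    then have "(\<lambda>r. k0 * Q ^ r) \<longlonglongrightarrow> k0 * 0"
      using Q by (intro tendsto_mult tendsto_const LIMSEQ_realpow_zero) auto
    then have "eventually (\<lambda>r. k0 * Q ^ r < 1) sequentially"
      by (intro order_tendstoD(2)) auto
    then obtain R where R: "\<And>r. r \<ge> R \<Longrightarrow> k0 * Q ^ r < 1"
      by (auto simp: eventually_sequentially)
    have "q r = 0" if "r \<ge> R" for r
      using R[OF that] q_bound[of r] q_int[of r] by fastforce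
    then show False using det[of R] by simp
  qed
  have \<kappa>: "\<kappa> \<ge> 0" using Q1 E by (simp add: \<kappa>_def)
  have M: "M > 0" "E \<le> M" "2 * l0 * E \<le> M" using E by (auto simp: M_def)
  define r0 where "r0 = (LEAST r. 2 * l0 * cmod b \<le> E ^ r)"
  have "\<exists>r. 2 * l0 * cmod b \<le> E ^ r"
    using real_arch_pow[OF E, of "2 * l0 * cmod b"] by (auto intro: less_imp_le)
  then have r0: "2 * l0 * cmod b \<le> E ^ r0"
    unfolding r0_def by (rule LeastI_ex)
  \<comment> \<open>Minimality of \<open>r0\<close> loses at most a factor \<open>E\<close>, while
    \<open>r0 = 0\<close> is covered by \<open>M \<ge> E\<close>: hence the two entries of the
    maximum.\<close>
  have r0_le: "E ^ r0 \<le> M * cmod b"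
  proof (cases r0)
    case 0
    have "1 * 1 \<le> M * cmod b"
      using M E b by (intro mult_mono) auto
    then show ?thesis using 0 by simp
  next
    case (Suc j)
    then have "\<not> 2 * l0 * cmod b \<le> E ^ j"
      unfolding r0_def by (metis not_less_Least lessI)
    then have "E ^ r0 \<le> (2 * l0 * cmod b) * E"
      using E unfolding Suc by (simp add: mult.commute)
    also have "\<dots> = 2 * l0 * E * cmod b" by simp
    also have "\<dots> \<le> M * cmod b"
      using M by (intro mult_right_mono) auto
    finally show ?thesis .
  qed
  \<comment> \<open>If both expressions vanished, eliminating \<open>a\<close> would contradict
    \<open>det\<close>.\<close>
  obtain r where r: "r \<in> {r0, Suc r0}" "a * q r - p r * b \<noteq> 0"
  proof (cases "a * q r0 - p r0 * b = 0 \<and> a * q (Suc r0) - p (Suc r0) * b = 0")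
    case True
    have "(p r0 * q (Suc r0) - p (Suc r0) * q r0) * b =
      (p r0 * b - a * q r0) * q (Suc r0) - (p (Suc r0) * b - a * q (Suc r0)) * q r0"
      by (simp add: algebra_simps)
    also have "\<dots> = 0" using True by simp
    finally show thesis using det[of r0] b0 by simp
  qed (use that in auto)
  have "1 \<le> cmod (a * q r - p r * b)" by (rule lin) fact
  also have "a * q r - p r * b = b * (q r * \<alpha> - p r) - q r * (b * \<alpha> - a)"
    by (simp add: algebra_simps)
  also have "b * \<alpha> - a = b * (\<alpha> - a / b)" using b0 by (simp add: algebra_simps)
  also have "cmod (b * (q r * \<alpha> - p r) - q r * (b * (\<alpha> - a / b))) \<le>
    cmod b * cmod (q r * \<alpha> - p r) + cmod (q r) * (cmod b * err)"
    unfolding err_def by (metis norm_mult norm_triangle_ineq4)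
  also have "cmod b * cmod (q r * \<alpha> - p r) \<le> 1 / 2"
  proof -
    have "E ^ r0 \<le> E ^ r" using r E by (intro power_increasing) auto
    with r0 have "2 * l0 * cmod b \<le> E ^ r" by simp
    then have "cmod b * (l0 * (1 / E) ^ r) \<le> 1 / 2"
      using E by (simp add: power_one_over field_simps)
    moreover have "cmod b * cmod (q r * \<alpha> - p r) \<le> cmod b * (l0 * (1 / E) ^ r)"
      by (intro mult_left_mono rem_bound) auto
    ultimately show ?thesis by simp
  qed
  finally have half: "1 / 2 \<le> cmod (q r) * (cmod b * err)" by simp
  then have "cmod (q r) * (cmod b * err) > 0" by simp
  then have bX: "cmod b * err > 0"
    by (metis err_def mult_nonneg_nonneg norm_ge_zero not_less_iff_gr_or_eq mult_zero_right order_le_less)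
  have "cmod (q r) * (cmod b * err) < k0 * Q ^ r * (cmod b * err)"
    using bX q_bound by (intro mult_strict_right_mono) auto
  \<comment> \<open>The index may be \<open>Suc r0\<close>, which costs the single factor
    \<open>Q\<close>.\<close>
  also have "\<dots> \<le> k0 * Q ^ Suc r0 * (cmod b * err)"
    using r bX k0 Q1 by (intro mult_right_mono mult_left_mono power_increasing) auto
  also have "\<dots> \<le> k0 * (Q * (M powr \<kappa> * cmod b powr \<kappa>)) * (cmod b * err)"
  proof -
    have "Q ^ r0 = (E ^ r0) powr \<kappa>"
    proof -
      have "E powr \<kappa> = Q"
        using E Q by (simp add: powr_def \<kappa>_def)
      moreover have "(E ^ r0) powr \<kappa> = (E powr \<kappa>) ^ r0"
        using E by (simp add: powr_powr mult.commute flip: powr_realpow)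
      ultimately show ?thesis by simp
    qed
    also have "\<dots> \<le> (M * cmod b) powr \<kappa>"
      using E \<kappa> r0_le by (intro powr_mono2) auto
    also have "\<dots> = M powr \<kappa> * cmod b powr \<kappa>"
      using M by (simp add: powr_mult)
    finally have "Q ^ r0 \<le> M powr \<kappa> * cmod b powr \<kappa>" .
    then show ?thesis
      using bX k0 Q by (intro mult_right_mono mult_left_mono) auto
  qed
  finally have "1 / 2 < k0 * (Q * (M powr \<kappa> * cmod b powr \<kappa>)) * (cmod b * err)"
    using half by linarith
  then have "1 < 2 * k0 * Q * M powr \<kappa> * (cmod b powr \<kappa> * cmod b) * err"
    by (simp add: algebra_simps)
  also have "cmod b powr \<kappa> * cmod b = cmod b powr (\<kappa> + 1)"
    by (simp add: powr_add)
  finally have "1 < 2 * k0 * Q * M powr \<kappa> * cmod b powr (\<kappa> + 1) * err" .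
  moreover have "2 * k0 * Q * M powr \<kappa> * cmod b powr (\<kappa> + 1) > 0"
    using k0 Q M b0 by simp
  ultimately have "1 / (2 * k0 * Q * M powr \<kappa> * cmod b powr (\<kappa> + 1)) < err"
    by (simp add: divide_less_eq mult.commute)
  then show ?thesis
    unfolding err_def M_def \<kappa>_def .
qed

theorem theorem2:
  fixes m n d :: nat
    and K L :: "complex set"
    and \<sigma> :: "complex \<Rightarrow> complex"
    and \<tau> \<beta> \<gamma> \<eta> g s \<omega> \<alpha> :: complex
    and hr :: "nat \<Rightarrow> complex"
    and h Cn Dn E Q \<kappa> c :: real
  assumes mn: "0 < m" "m < n" "gcd m n = 1"
    and K: "imaginary_quadratic_field K"
    and L: "number_field L" "K \<subseteq> L" "ring.dimension C_field 2 K L"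
    and \<sigma>: "\<sigma> \<in> Galois_group L K" "\<exists>x\<in>L. \<sigma> x \<noteq> x"
    and \<tau>: "\<tau> \<in> K" "algebraic_int \<tau>" "L = generate_field C_field (insert (csqrt \<tau>) K)"
    and \<beta>: "\<beta> \<in> L" "algebraic_int \<beta>"
    and \<gamma>: "\<gamma> \<in> L" "algebraic_int \<gamma>"
    and \<eta>: "\<eta> \<in> L" "algebraic_int \<eta>"
    and nondegenerate: "\<beta> * \<sigma> \<gamma> \<noteq> \<gamma> * \<sigma> \<beta>"
    and g: "algebraic g" "g \<noteq> 0" "algebraic_int (\<eta> / g)" "algebraic_int (\<sigma> \<eta> / g)"
    and h: "h > 0"
    and hr: "\<And>r. hr r \<noteq> 0" "\<And>r. algebraic_int (hr r)" "\<And>r. hr r / g ^ r \<in> K"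
            "\<And>r. cmod (hr r) \<le> h"
    and d: "d > 0" "algebraic_int ((\<sigma> \<eta> - \<eta>) / (of_nat d * g))"
           "\<And>d'. d' > 0 \<Longrightarrow> algebraic_int ((\<sigma> \<eta> - \<eta>) / (of_nat d' * g)) \<Longrightarrow> d' \<le> d"
    and CD: "Cn > 0" "Dn > 0"
    and bound: "\<And>r.
        Max {1,
             Gamma (1 - real m / real n) * fact r / Gamma (real r + 1 - real m / real n),
             real n * Gamma (real r + 1 + real m / real n) /
               (real m * Gamma (real m / real n) * fact r)}
          * (real (X_denom m n r) / of_int (X_numer_gcd m n d r))
        < Cn * (Dn / N_prod d n) ^ r"
    and s: "s = 1 \<or> s = - 1"
    and \<omega>: "\<omega> = (\<eta> / \<sigma> \<eta>) powr of_real (real m / real n)"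
    and denominator: "\<gamma> * \<omega> + s * \<sigma> \<gamma> \<noteq> 0"
    and \<alpha>: "\<alpha> = (\<beta> * \<omega> + s * \<sigma> \<beta>) / (\<gamma> * \<omega> + s * \<sigma> \<gamma>)"
    and E: "E = 4 * cmod g * N_prod d n / Dn *
                ((cmod \<eta> - cmod (\<sigma> \<eta> - \<eta>)) / cmod (\<sigma> \<eta> - \<eta>) ^ 2)"
    and Q: "Q = 2 * Dn / (cmod g * N_prod d n) * (cmod \<eta> + cmod (\<sigma> \<eta>))"
    and \<kappa>: "\<kappa> = ln Q / ln E"
    and c: "c = 4 * h * cmod (csqrt \<tau>) * (cmod \<gamma> + cmod (\<sigma> \<gamma>)) * Cn * Q *
                (max E (2 * h * cmod (csqrt \<tau>) * cmod (1 - \<omega>) * cmod (\<beta> - \<alpha> * \<gamma>) * Cn * E))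
                  powr \<kappa>"
    and E_gt_1: "E > 1"
    and near_1: "max (cmod (1 - \<eta> / \<sigma> \<eta>)) (cmod (1 - \<sigma> \<eta> / \<eta>)) < 1"
  shows "\<forall>p\<in>K. \<forall>q\<in>K. algebraic_int p \<longrightarrow> algebraic_int q \<longrightarrow> q \<noteq> 0 \<longrightarrow>
           cmod (\<alpha> - p / q) > 1 / (c * cmod q powr (\<kappa> + 1))"
proof (intro ballI impI)
  fix a b :: complex
  assume a: "a \<in> K" "algebraic_int a" and b: "b \<in> K" "algebraic_int b" "b \<noteq> 0"
  define \<nu> w N where "\<nu> = real m / real n" and "w = csqrt \<tau>" and "N = N_prod d n"
  have \<nu>: "0 < \<nu>" "\<nu> < 1" and n0: "0 < n"
    using mn by (auto simp: \<nu>_def)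
  have K_sub: "subfield K C_field" and L_sub: "subfield L C_field"
    using K L by (auto simp: imaginary_quadratic_field_def number_field_def)
  interpret complex_involution K L \<sigma> w
    using K_sub L_sub L(2) \<sigma> \<tau> by (intro complex_involutionI) (auto simp: w_def)
  note norm_ge_1 = imaginary_quadratic_field_norm_ge_1[OF K]
  \<comment> \<open>The bound \<open>1 \<le> cmod w\<close> lets \<open>cmod w\<close> dominate both
    choices of the factor \<open>u\<close> below.\<close>
  have w: "algebraic_int w" "1 \<le> cmod w"
  proof -
    show "algebraic_int w" using \<tau> by (auto simp: w_def)
    have "\<tau> \<noteq> 0" using w_nonzero by (auto simp: w_def)
    then have "1 \<le> cmod (w\<^sup>2)"
      using norm_ge_1[OF \<tau>(1,2)] by (simp add: w_def)
    then have "1\<^sup>2 \<le> (cmod w)\<^sup>2" by (simp add: norm_power)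
    then show "1 \<le> cmod w" by (rule power2_le_imp_le) simp
  qed
  have N: "N > 0"
    unfolding N_def N_prod_def by (intro prod_pos) (auto dest: in_prime_factors_imp_prime prime_gt_0_nat)

  define \<eta>' z where "\<eta>' = \<sigma> \<eta>" and "z = \<eta> / \<eta>'"
  have nz: "\<eta> \<noteq> 0" "\<eta>' \<noteq> 0"
    using near_1 by (auto simp: \<eta>'_def)
  have \<eta>'L: "\<eta>' \<in> L" and \<sigma>\<eta>': "\<sigma> \<eta>' = \<eta>"
    using \<eta> by (auto simp: \<eta>'_def \<sigma>_mem \<sigma>_involutive)
  have z: "cmod (1 - z) < cmod z" "cmod (1 - z) < 1" "z \<noteq> 0" "1 / z = \<eta>' / \<eta>"
  proof -
    show z0: "z \<noteq> 0" and inv: "1 / z = \<eta>' / \<eta>" using nz by (auto simp: z_def)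
    show "cmod (1 - z) < 1" using near_1 by (simp add: z_def \<eta>'_def)
    have "cmod (1 - 1 / z) < 1" using near_1 unfolding inv by (simp add: \<eta>'_def)
    then have "cmod z * cmod (1 - 1 / z) < cmod z * 1"
      using z0 by (intro mult_strict_left_mono) auto
    also have "cmod z * cmod (1 - 1 / z) = cmod (z - 1)"
      using z0 by (simp add: right_diff_distrib flip: norm_mult)
    finally show "cmod (1 - z) < cmod z" by (simp add: norm_minus_commute)
  qed
  \<comment> \<open>For \<open>\<sigma> \<eta> = \<eta>\<close>, division by zero would give
    \<open>E = 0\<close>.\<close>
  have \<eta>_ne: "\<eta>' \<noteq> \<eta>"
    using E E_gt_1 by (auto simp: \<eta>'_def)
  then have z1: "z \<noteq> 1" using nz by (auto simp: z_def)

  define P P' where "P r = \<eta> ^ r * poly (hyp_poly \<nu> r) (\<eta>' / \<eta>)"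
    and "P' r = \<eta>' ^ r * poly (hyp_poly \<nu> r) (\<eta> / \<eta>')" for r
  have P_rev: "P r = \<eta>' ^ r * poly (hyp_rev \<nu> r) z" for r
    using nz poly_hyp_rev_nz[OF z(3), of \<nu> r] unfolding z(4) by (simp add: P_def z_def power_divide)
  have P'_z: "P' r = \<eta>' ^ r * poly (hyp_poly \<nu> r) z" for r
    by (simp add: P'_def z_def)
  \<comment> \<open>The homogeneous form has rational coefficients and no division, so \<sigma> just
    exchanges \<open>\<eta>\<close> and \<open>\<eta>'\<close>, hence \<open>P\<close> and
    \<open>P'\<close>.\<close>
  define H where "H r x y = (\<Sum>k\<le>r. Polynomial.coeff (hyp_poly \<nu> r) k * (x ^ k * y ^ (r - k)))" for r and x y :: complex
  have H: "y ^ r * poly (hyp_poly \<nu> r) (x / y) = H r x y" if "y \<noteq> 0" for r and x y :: complex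
    unfolding poly_hyp_poly H_def sum_distrib_left
    using that by (intro sum.cong) (auto simp: coeff_hyp_poly power_divide power_diff)
  have coeff_rat: "Polynomial.coeff (hyp_poly \<nu> r) k \<in> \<rat>" for r k
  proof -
    have "Polynomial.coeff (hyp_poly \<nu> r) k = of_rat (Polynomial.coeff (X_poly m n r) k)"
      using map_poly_X_poly[OF mn(1) n0, of r] unfolding \<nu>_def by (metis coeff_map_poly of_rat_0)
    then show ?thesis by simp
  qed
  have H_\<sigma>: "H r x y \<in> L" "\<sigma> (H r x y) = H r (\<sigma> x) (\<sigma> y)" if "x \<in> L" "y \<in> L" for r x y
  proof -
    have cL: "Polynomial.coeff (hyp_poly \<nu> r) k \<in> L" for k
      using coeff_rat L.Rats_subset by blast
    show "H r x y \<in> L"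
      unfolding H_def using that by (intro L.sum_mem L.mult_mem L.power_mem cL)
    have "\<sigma> (H r x y) = (\<Sum>k\<le>r. \<sigma> (Polynomial.coeff (hyp_poly \<nu> r) k * (x ^ k * y ^ (r - k))))"
      unfolding H_def using that by (intro \<sigma>_sum L.mult_mem L.power_mem cL)
    also have "\<dots> = H r (\<sigma> x) (\<sigma> y)"
      unfolding H_def using that
      by (intro sum.cong refl) (simp add: \<sigma>_mult L.mult_mem L.power_mem cL \<sigma>_power \<sigma>_rat coeff_rat)
    finally show "\<sigma> (H r x y) = H r (\<sigma> x) (\<sigma> y)" .
  qed
  have PH: "P r = H r \<eta>' \<eta>" "P' r = H r \<eta> \<eta>'" for r
    using nz by (simp_all add: P_def P'_def H)
  have P: "P r \<in> L" "P' r \<in> L" "\<sigma> (P r) = P' r" "\<sigma> (P' r) = P r" for r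
    unfolding PH using \<eta> \<eta>'L \<sigma>\<eta>' by (simp_all add: H_\<sigma> flip: \<eta>'_def)

  \<comment> \<open>Integrality of the scaled values\<close>
  define D where "D r = real (X_denom m n r) / of_int (X_numer_gcd m n d r)" for r
  have D: "D r > 0" for r
    using X_denom(1)[of m n r] X_numer_gcd_pos[OF d(1), of m n r] by (simp add: D_def)
  have cD: "complex_of_real (D r) = of_nat (X_denom m n r) / of_int (X_numer_gcd m n d r)" for r
    by (simp add: D_def)
  have D_mem: "complex_of_real (D r) \<in> K" for r
    unfolding cD by (intro K.divide_mem K.of_nat_mem K.of_int_mem)
  have P_int: "algebraic_int (of_real (D r) * P r / g ^ r)" "algebraic_int (of_real (D r) * P' r / g ^ r)" for r
  proof -
    have "algebraic_int ((\<eta>' - \<eta>) / (of_nat d * g))" using d by (simp add: \<eta>'_def)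
    moreover have "(\<eta> - \<eta>') / (of_nat d * g) = - ((\<eta>' - \<eta>) / (of_nat d * g))"
      by (simp only: minus_divide_left minus_diff_eq)
    ultimately have "algebraic_int ((\<eta> - \<eta>') / (of_nat d * g))"
      by (simp only: algebraic_int_minus_iff)
    then show "algebraic_int (of_real (D r) * P r / g ^ r)"
      unfolding cD P_def \<nu>_def using nz g d
      by (intro algebraic_int_scaled_X_poly mn(1) n0) auto
    show "algebraic_int (of_real (D r) * P' r / g ^ r)"
      unfolding cD P'_def \<nu>_def using nz g d
      by (intro algebraic_int_scaled_X_poly mn(1) n0) (auto simp: \<eta>'_def)
  qed

  \<comment> \<open>The approximations to \<open>\<alpha>\<close> are \<open>A \<beta> r / A \<gamma> r\<close>. Up to a factor in \<open>K\<close>, \<open>A x r\<close> is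
    a trace if \<open>s = 1\<close>, and anti-invariant before multiplication by \<open>w\<close> if \<open>s = -1\<close>.\<close>
  define u where "u = (if s = 1 then 1 else w)"
  have u: "u \<noteq> 0" "algebraic_int u" "cmod u \<le> cmod w"
    using w w_nonzero by (auto simp: u_def)
  \<comment> \<open>\<open>T r\<close> lies in \<open>K\<close>, whereas \<open>1 / g ^ r\<close>
    alone need not; the correcting factor \<open>hr r\<close> is an algebraic integer.\<close>
  define T where "T r = of_real (D r) * (hr r / g ^ r)" for r
  have T: "T r \<noteq> 0" "T r \<in> K" for r
  proof -
    show "T r \<noteq> 0" unfolding T_def using D[of r] hr(1) g(2) by simp
    show "T r \<in> K" unfolding T_def by (intro K.mult_mem D_mem hr)
  qed
  define A where "A x r = u * T r * (x * P' r + s * \<sigma> x * P r)" for x r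
  have A_mem: "A x r \<in> K" if "x \<in> L" for x r
  proof -
    have x: "x * P' r \<in> L" "\<sigma> (x * P' r) = \<sigma> x * P r"
      using that P by (simp_all add: L.mult_mem \<sigma>_mult)
    have "u * (x * P' r + s * \<sigma> x * P r) \<in> K"
    proof (cases "s = 1")
      case True
      then show ?thesis using trace_mem[OF x(1)] by (simp add: u_def x)
    next
      case False
      then show ?thesis using antitrace_mem[OF x(1)] s by (simp add: u_def x)
    qed
    then have "T r * (u * (x * P' r + s * \<sigma> x * P r)) \<in> K"
      by (rule K.mult_mem[OF T(2)])
    then show ?thesis by (simp add: A_def mult_ac)
  qed
  have s_int: "algebraic_int s" using s by auto
  have A_int: "algebraic_int (A x r)" if "x \<in> L" "algebraic_int x" for x r
  proof -
    have "A x r = u * hr r * (x * (of_real (D r) * P' r / g ^ r) + s * \<sigma> x * (of_real (D r) * P r / g ^ r))"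
      by (simp add: A_def T_def algebra_simps add_divide_distrib)
    also have "algebraic_int \<dots>"
      using that by (intro algebraic_int_mult algebraic_int_add u hr s_int P_int algebraic_int_\<sigma>)
    finally show ?thesis .
  qed

  \<comment> \<open>Size of the denominators of the approximations\<close>
  define S where "S = cmod \<eta> + cmod \<eta>'"
  have S: "S > 0" using nz by (simp add: S_def add_pos_pos)
  define G1 G2 where "G1 r = fact r / pochhammer (1 - \<nu>) r" and "G2 r = pochhammer (1 + \<nu>) r / fact r" for r
  have bound': "G1 r * D r < Cn * (Dn / N) ^ r" "G2 r * D r < Cn * (Dn / N) ^ r" for r
  proof -
    have notin: "x \<notin> \<int>\<^sub>\<le>\<^sub>0" if "x > 0" for x :: real
      using that nonpos_Ints_nonpos[of x] by auto
    have args: "real r + 1 - \<nu> = 1 - \<nu> + real r" "real r + 1 + \<nu> = 1 + \<nu> + real r"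
      by simp_all
    have m_eq: "real m = \<nu> * real n"
      using n0 by (simp add: \<nu>_def)
    have "pochhammer (1 - \<nu>) r = Gamma (1 - \<nu> + real r) / Gamma (1 - \<nu>)"
      using \<nu> by (intro pochhammer_Gamma notin) simp
    then have 1: "Gamma (1 - real m / real n) * fact r / Gamma (real r + 1 - real m / real n) = G1 r"
      unfolding \<nu>_def[symmetric] args G1_def by (simp add: mult.commute)
    have "pochhammer (1 + \<nu>) r = Gamma (1 + \<nu> + real r) / Gamma (1 + \<nu>)"
      using \<nu> by (intro pochhammer_Gamma notin) simp
    \<comment> \<open>Turns the third entry of the maximum, with its factor \<open>n / m\<close>,
      into \<open>G2 r\<close>.\<close>
    also have "Gamma (1 + \<nu>) = \<nu> * Gamma \<nu>"
      using Gamma_plus1[OF notin[OF \<nu>(1)]] by (simp add: add.commute)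
    finally have 2: "real n * Gamma (real r + 1 + real m / real n) /
        (real m * Gamma (real m / real n) * fact r) = G2 r"
      using n0 unfolding \<nu>_def[symmetric] args G2_def by (simp add: m_eq)
    have "G1 r \<le> Max {1, G1 r, G2 r}" "G2 r \<le> Max {1, G1 r, G2 r}" by simp_all
    then have "G1 r * D r \<le> Max {1, G1 r, G2 r} * D r" "G2 r * D r \<le> Max {1, G1 r, G2 r} * D r"
      using D[of r] by (auto intro!: mult_right_mono)
    moreover have "Max {1, G1 r, G2 r} * D r < Cn * (Dn / N) ^ r"
      using bound[of r] unfolding 1 2 D_def[symmetric] N_def[symmetric] .
    ultimately show "G1 r * D r < Cn * (Dn / N) ^ r" "G2 r * D r < Cn * (Dn / N) ^ r" by linarith+
  qed
  have T_bound: "cmod (T r) \<le> D r * (h / cmod g ^ r)" for r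
    using D[of r] hr(4)[of r] g by (simp add: T_def norm_mult norm_divide norm_power divide_right_mono)

  define k0 where "k0 = 2 * h * cmod w * (cmod \<gamma> + cmod (\<sigma> \<gamma>)) * Cn"
  have P_bound: "cmod (P r) \<le> 2 * G1 r * (2 * S) ^ r" "cmod (P' r) \<le> 2 * G1 r * (2 * S) ^ r" for r
  proof -
    have "cmod (y ^ r * poly (hyp_poly \<nu> r) (x / y)) \<le> 2 * G1 r * (2 * (cmod x + cmod y)) ^ r"
      if "y \<noteq> 0" for x y
    proof -
      have "cmod (y ^ r * poly (hyp_poly \<nu> r) (x / y)) \<le>
          cmod y ^ r * (2 * G1 r * (2 * (1 + cmod (x / y))) ^ r)"
        unfolding norm_mult norm_power G1_def by (intro mult_left_mono hyp_poly_bound[OF \<nu>]) auto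
      also have "\<dots> = 2 * G1 r * (cmod y * (2 * (1 + cmod (x / y)))) ^ r"
        by (simp add: power_mult_distrib)
      also have "cmod y * (2 * (1 + cmod (x / y))) = 2 * (cmod x + cmod y)"
        using that by (simp add: norm_divide distrib_left)
      finally show ?thesis .
    qed
    from this[of \<eta> \<eta>'] this[of \<eta>' \<eta>] show "cmod (P r) \<le> 2 * G1 r * (2 * S) ^ r"
      "cmod (P' r) \<le> 2 * G1 r * (2 * S) ^ r"
      using nz by (simp_all add: P_def P'_def S_def add.commute)
  qed
  \<comment> \<open>The strict bound for \<open>A \<gamma> r\<close> needs this factor
    positive.\<close>
  have \<gamma>_pos: "cmod \<gamma> + cmod (\<sigma> \<gamma>) > 0"
  proof -
    have "\<gamma> \<noteq> 0" using nondegenerate \<sigma>_fix[of 0] by auto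
    then show ?thesis by (simp add: add_pos_nonneg)
  qed
  have Q': "Q = Dn / N * (2 * S / cmod g)"
    unfolding Q N_def[symmetric] \<eta>'_def[symmetric] S_def[symmetric] by (simp add: mult_ac)
  have q_bound: "cmod (A \<gamma> r) < k0 * Q ^ r" for r
  proof -
    define B where "B = 2 * G1 r * (2 * S) ^ r"
    have "cmod (\<gamma> * P' r + s * \<sigma> \<gamma> * P r) \<le> cmod \<gamma> * cmod (P' r) + cmod (\<sigma> \<gamma>) * cmod (P r)"
      using norm_triangle_ineq[of "\<gamma> * P' r" "s * \<sigma> \<gamma> * P r"] s by (auto simp: norm_mult)
    also have "\<dots> \<le> cmod \<gamma> * B + cmod (\<sigma> \<gamma>) * B"
      unfolding B_def by (intro add_mono mult_left_mono P_bound) auto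
    finally have "cmod (\<gamma> * P' r + s * \<sigma> \<gamma> * P r) \<le> (cmod \<gamma> + cmod (\<sigma> \<gamma>)) * B"
      by (simp add: algebra_simps)
    then have "cmod (A \<gamma> r) \<le> cmod w * (D r * (h / cmod g ^ r)) * ((cmod \<gamma> + cmod (\<sigma> \<gamma>)) * B)"
      unfolding A_def norm_mult using D[of r] h by (intro mult_mono T_bound u) auto
    also have "\<dots> = (2 * h * cmod w * (cmod \<gamma> + cmod (\<sigma> \<gamma>)) * (2 * S / cmod g) ^ r) * (G1 r * D r)"
      by (simp add: B_def power_divide)
    also have "\<dots> < (2 * h * cmod w * (cmod \<gamma> + cmod (\<sigma> \<gamma>)) * (2 * S / cmod g) ^ r) * (Cn * (Dn / N) ^ r)"
      using h w_nonzero \<gamma>_pos S g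
      by (intro mult_strict_left_mono bound' mult_pos_pos zero_less_power) auto
    also have "\<dots> = k0 * Q ^ r"
      unfolding Q' k0_def by (simp only: power_mult_distrib mult_ac)
    finally show ?thesis .
  qed

  \<comment> \<open>Size of the remainders\<close>
  define l0 where "l0 = h * cmod w * cmod (1 - \<omega>) * cmod (\<beta> - \<alpha> * \<gamma>) * Cn"
  define B where "B = (cmod (\<eta>' - \<eta>))\<^sup>2 / (4 * (cmod \<eta> - cmod (\<eta>' - \<eta>)))"
  have \<omega>z: "\<omega> = z powr of_real \<nu>"
    by (simp add: \<omega> z_def \<eta>'_def \<nu>_def)
  have dist_\<eta>: "cmod \<eta>' * cmod z = cmod \<eta>" "cmod \<eta>' * cmod (1 - z) = cmod (\<eta>' - \<eta>)"
    using nz by (simp_all add: z_def right_diff_distrib flip: norm_mult)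
  have \<eta>_pos: "cmod \<eta> - cmod (\<eta>' - \<eta>) > 0"
  proof -
    have "cmod \<eta>' * cmod (1 - z) < cmod \<eta>' * cmod z"
      using z(1) nz by (intro mult_strict_left_mono) auto
    then show ?thesis unfolding dist_\<eta> by simp
  qed
  have B0: "B \<ge> 0" using \<eta>_pos by (simp add: B_def)
  have remainder: "cmod (\<omega> * P r - P' r) \<le> G2 r * cmod (1 - \<omega>) * B ^ r" for r
  proof -
    have "cmod (\<omega> * P r - P' r) = cmod \<eta>' ^ r *
        cmod (z powr of_real \<nu> * poly (hyp_rev \<nu> r) z - poly (hyp_poly \<nu> r) z)"
      unfolding P_rev P'_z \<omega>z by (simp add: algebra_simps flip: norm_mult norm_power)
    also have "\<dots> \<le> cmod \<eta>' ^ r * (G2 r * cmod (1 - \<omega>) *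
        ((cmod (1 - z))\<^sup>2 / (4 * (cmod z - cmod (1 - z)))) ^ r)"
      unfolding G2_def \<omega>z by (intro mult_left_mono hyp_remainder_bound[OF \<nu> z(1,2)]) auto
    also have "\<dots> = G2 r * cmod (1 - \<omega>) *
        (cmod \<eta>' * ((cmod (1 - z))\<^sup>2 / (4 * (cmod z - cmod (1 - z))))) ^ r"
      by (simp only: power_mult_distrib mult_ac)
    also have "cmod \<eta>' * ((cmod (1 - z))\<^sup>2 / (4 * (cmod z - cmod (1 - z)))) = B"
    proof -
      have "B = (cmod \<eta>' * cmod (1 - z))\<^sup>2 / (4 * (cmod \<eta>' * cmod z - cmod \<eta>' * cmod (1 - z)))"
        unfolding dist_\<eta> B_def ..
      also have "\<dots> = (cmod \<eta>' * (cmod \<eta>' * (cmod (1 - z))\<^sup>2)) / (cmod \<eta>' * (4 * (cmod z - cmod (1 - z))))"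
        by (simp add: power2_eq_square algebra_simps)
      also have "\<dots> = cmod \<eta>' * (cmod (1 - z))\<^sup>2 / (4 * (cmod z - cmod (1 - z)))"
        using nz by (subst mult_divide_mult_cancel_left) auto
      finally show ?thesis by simp
    qed
    finally show ?thesis .
  qed
  have E': "1 / E = Dn / N * (B / cmod g)"
    using CD N g \<eta>_ne \<eta>_pos unfolding E B_def \<eta>'_def[symmetric] N_def[symmetric]
    by (simp add: field_simps)
  have rem_bound: "cmod (A \<gamma> r * \<alpha> - A \<beta> r) \<le> l0 * (1 / E) ^ r" for r
  proof -
    have "\<alpha> * (\<gamma> * \<omega> + s * \<sigma> \<gamma>) = \<beta> * \<omega> + s * \<sigma> \<beta>"
      using denominator by (simp add: \<alpha>)
    \<comment> \<open>Solving the definition of \<alpha> for the coefficient of \<open>P r\<close>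
      makes \<open>\<omega> * P r - P' r\<close> a factor of the linear form.\<close>
    then have \<alpha>_eq: "s * (\<alpha> * \<sigma> \<gamma> - \<sigma> \<beta>) = (\<beta> - \<alpha> * \<gamma>) * \<omega>"
      by (simp add: algebra_simps)
    have "A \<gamma> r * \<alpha> - A \<beta> r =
        u * T r * ((\<alpha> * \<gamma> - \<beta>) * P' r + (s * (\<alpha> * \<sigma> \<gamma> - \<sigma> \<beta>)) * P r)"
      by (simp add: A_def algebra_simps)
    also have "\<dots> = u * T r * ((\<beta> - \<alpha> * \<gamma>) * (\<omega> * P r - P' r))"
      unfolding \<alpha>_eq by (simp add: algebra_simps)
    also have "cmod \<dots> \<le> cmod w * (D r * (h / cmod g ^ r)) *
        (cmod (\<beta> - \<alpha> * \<gamma>) * (G2 r * cmod (1 - \<omega>) * B ^ r))"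
      unfolding norm_mult using D[of r] h by (intro mult_mono T_bound u remainder) auto
    also have "\<dots> = (h * cmod w * cmod (1 - \<omega>) * cmod (\<beta> - \<alpha> * \<gamma>) * (B / cmod g) ^ r) * (G2 r * D r)"
      by (simp add: power_divide)
    also have "\<dots> \<le> (h * cmod w * cmod (1 - \<omega>) * cmod (\<beta> - \<alpha> * \<gamma>) * (B / cmod g) ^ r) * (Cn * (Dn / N) ^ r)"
      using h B0 by (intro mult_left_mono less_imp_le[OF bound'(2)] mult_nonneg_nonneg zero_le_power) auto
    also have "\<dots> = l0 * (1 / E) ^ r"
      unfolding E' l0_def by (simp only: power_mult_distrib mult_ac)
    finally show ?thesis .
  qed

  \<comment> \<open>Up to nonzero factors this is
    \<open>\<beta> * \<sigma> \<gamma> - \<gamma> * \<sigma> \<beta>\<close>, nonzero by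
    \<open>nondegenerate\<close>, times the hypergeometric determinant.\<close>
  have det: "A \<beta> r * A \<gamma> (Suc r) \<noteq> A \<beta> (Suc r) * A \<gamma> r" for r
  proof -
    have "A \<beta> r * A \<gamma> (Suc r) - A \<beta> (Suc r) * A \<gamma> r =
        u\<^sup>2 * T r * T (Suc r) * s * (\<beta> * \<sigma> \<gamma> - \<gamma> * \<sigma> \<beta>) * (P' r * P (Suc r) - P' (Suc r) * P r)"
      by (simp add: A_def algebra_simps power2_eq_square)
    also have "P' r * P (Suc r) - P' (Suc r) * P r = \<eta>' ^ r * \<eta>' ^ Suc r *
        (poly (hyp_poly \<nu> r) z * poly (hyp_rev \<nu> (Suc r)) z -
         poly (hyp_poly \<nu> (Suc r)) z * poly (hyp_rev \<nu> r) z)"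
      unfolding P_rev P'_z by (simp add: algebra_simps)
    finally have "A \<beta> r * A \<gamma> (Suc r) - A \<beta> (Suc r) * A \<gamma> r \<noteq> 0"
      using u T s nondegenerate nz hyp_determinant_nonzero[OF \<nu> z1, of r] by auto
    then show ?thesis by simp
  qed

  have "1 / (2 * k0 * Q * max E (2 * l0 * E) powr (ln Q / ln E) * cmod b powr (ln Q / ln E + 1)) <
    cmod (\<alpha> - a / b)"
  proof (rule irrationality_measure_from_approximations[where p = "A \<beta>" and q = "A \<gamma>"])
    fix r
    show "1 \<le> cmod (a * A \<gamma> r - A \<beta> r * b)" if "a * A \<gamma> r - A \<beta> r * b \<noteq> 0"
      using that a b \<beta> \<gamma>
      by (intro norm_ge_1 algebraic_int_diff algebraic_int_mult A_int K.diff_mem K.mult_mem A_mem)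
    show "1 \<le> cmod (A \<gamma> r)" if "A \<gamma> r \<noteq> 0"
      using that \<gamma> by (intro norm_ge_1 A_int A_mem)
  next
    show "1 \<le> cmod b" using b by (intro norm_ge_1)
    show "Q > 0" unfolding Q' using CD N S g by simp
    show "l0 \<ge> 0" using h CD by (simp add: l0_def)
  qed (use det q_bound rem_bound E_gt_1 in auto)
  \<comment> \<open>In the constant \<open>4\<close> of \<open>c\<close>, one \<open>2\<close> comes
    from the polynomial bound in \<open>k0\<close>, the other from the half of the linear form that
    is kept.\<close>
  also have "2 * k0 * Q * max E (2 * l0 * E) powr (ln Q / ln E) = c"
    unfolding c k0_def l0_def \<kappa> w_def by (simp add: mult_ac)
  finally show "1 / (c * cmod b powr (\<kappa> + 1)) < cmod (\<alpha> - a / b)"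
    unfolding \<kappa> .
qed

end
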